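(* Let $p,t,k_1,\dots,k_p\ge1$ be integers, let $X=X_1\,\dot\cup\,\cdots\,\dot\cup\,X_p$ be a finite set partitioned into blocks with $|X_i|=n_i$, put $\boldsymbol k=(k_1,\ldots,k_p)$, $\boldsymbol n=(n_1,\ldots,n_p)$, $K=\sum_{i=1}^p k_i$, $n_*=\min_{i\in[p]}n_i$, and suppose $K\ge t+2$. Let \[ \Lambda_{K,t}=\max\left\{3t^2(K-t+1)^2,\ 2(t+1)(K-t+1)^3\right\}. \] If $n_*>K(1+\Lambda_{K,t})$, then every nontrivial $t$-intersecting subfamily $\mathcal F$ of $\mathcal H(\boldsymbol k)$ satisfies \[ |\mathcal F|\le\max_{(\boldsymbol a,\boldsymbol\ell)\in\mathcal E_t(\boldsymbol k)}H^\times_{\boldsymbol n,\boldsymbol k}(\boldsymbol a,\boldsymbol\ell). \] Equality holds if and only if $\mathcal F=\mathcal H^\times(T,Y)$, where $(T,Y)$ is a feasible pair whose profile is a maximizer of $H^\times_{\boldsymbol n,\boldsymbol k}$ over $\mathcal E_t(\boldsymbol k)$.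
   Context: $[m]=\{1,\ldots,m\}$, and $\binom{m}{\ell}=0$ whenever $\ell<0$ or $\ell>m$. $\mathcal H(\boldsymbol k)=\{F\subseteq X:|F\cap X_i|=k_i\text{ for every }i\in[p]\}$. A family $\mathcal F$ is $t$-intersecting if $|F\cap F'|\ge t$ for all $F,F'\in\mathcal F$; it is trivial if all its members contain a common $t$-set, and nontrivial otherwise. A set $C\subseteq X$ is admissible if $|C\cap X_i|\le k_i$ for every $i\in[p]$. For disjoint $T,Y\subseteq X$ with $|T|=t$ and $|Y|\ge2$, let \[ \mathcal H^\times(T,Y)=\{F\in\mathcal H(\boldsymbol k):T\subseteq F,\ F\cap Y\ne\varnothing\}\cup\bigcup_{x\in T}\{F\in\mathcal H(\boldsymbol k):F\cap T=T\setminus\{x\},\ Y\subseteq F\}. \] The profile of $(T,Y)$ is the pair $(\boldsymbol a,\boldsymbol\ell)$ with $a_i=|T\cap X_i|$, $\ell_i=|Y\cap X_i|$ for $i\in[p]$. Define \[ H^\times_{\boldsymbol n,\boldsymbol k}(\boldsymbol a,\boldsymbol\ell)=\prod_{i=1}^p\binom{n_i-a_i}{k_i-a_i}-\prod_{i=1}^p\binom{n_i-a_i-\ell_i}{k_i-a_i}+\sum_{i=1}^p a_i\binom{n_i-a_i-\ell_i}{k_i-a_i-\ell_i+1}\prod_{j\ne i}\binom{n_j-a_j-\ell_j}{k_j-a_j-\ell_j}. \] A pair $(T,Y)$ of disjoint subsets of $X$ is feasible if $T\cup\{y\}$ is admissible for every $y\in Y$ and $(T\setminus\{x\})\cup Y$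 is admissible for at least one $x\in T$. $\mathcal E_t(\boldsymbol k)$ is the set of profiles $(\boldsymbol a,\boldsymbol\ell)$ of feasible pairs $(T,Y)$ with $T\subseteq X\setminus Y$, $|T|=t$, that satisfy one of the following mutually exclusive conditions: (i) $\sum_i\ell_i=2$; (ii) $\sum_i\ell_i\ge3$, and for every $i\in[p]$, $\ell_i\in\{0,k_i\}$ and $\ell_i\le k_i-a_i$; (iii) $\sum_i\ell_i\ge3$, and there is a unique index $h$ with $1\le a_h\le k_h-1$ and $\ell_h=k_h-a_h+1$, while $\ell_i\in\{0,k_i-a_i\}$ for every $i\ne h$. *)

theory Defs
  imports Main "HOL-Library.FuncSet" "HOL-Library.Disjoint_Sets"
begin

text \<open>
  The blocks are \<open>X 1, \<dots>, X p\<close>; values of \<open>X\<close>, \<open>k\<close>, \<open>n\<close> at other indices play no role.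
\<close>

definition ground_set :: "nat \<Rightarrow> (nat \<Rightarrow> 'a set) \<Rightarrow> 'a set" where
  "ground_set p X = (\<Union>i\<in>{1..p}. X i)"

definition block_family :: "nat \<Rightarrow> (nat \<Rightarrow> 'a set) \<Rightarrow> (nat \<Rightarrow> nat) \<Rightarrow> 'a set set" where
  "block_family p X k = {F. F \<subseteq> ground_set p X \<and> (\<forall>i\<in>{1..p}. card (F \<inter> X i) = k i)}"

definition t_intersecting :: "nat \<Rightarrow> 'a set set \<Rightarrow> bool" where
  "t_intersecting t \<F> \<longleftrightarrow> (\<forall>F\<in>\<F>. \<forall>F'\<in>\<F>. t \<le> card (F \<inter> F'))"

definition t_trivial :: "nat \<Rightarrow> (nat \<Rightarrow> 'a set) \<Rightarrow> nat \<Rightarrow> 'a set set \<Rightarrow> bool" where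
  "t_trivial p X t \<F> \<longleftrightarrow> (\<exists>S \<subseteq> ground_set p X. card S = t \<and> (\<forall>F\<in>\<F>. S \<subseteq> F))"

definition admissible_set :: "nat \<Rightarrow> (nat \<Rightarrow> 'a set) \<Rightarrow> (nat \<Rightarrow> nat) \<Rightarrow> 'a set \<Rightarrow> bool" where
  "admissible_set p X k C \<longleftrightarrow>
     C \<subseteq> ground_set p X \<and> (\<forall>i\<in>{1..p}. card (C \<inter> X i) \<le> k i)"

definition cross_family ::
    "nat \<Rightarrow> (nat \<Rightarrow> 'a set) \<Rightarrow> (nat \<Rightarrow> nat) \<Rightarrow> 'a set \<Rightarrow> 'a set \<Rightarrow> 'a set set" where
  "cross_family p X k T Y =
     {F \<in> block_family p X k. T \<subseteq> F \<and> F \<inter> Y \<noteq> {}} \<union>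
     (\<Union>x\<in>T. {F \<in> block_family p X k. F \<inter> T = T - {x} \<and> Y \<subseteq> F})"

text \<open>
  A \<open>p\<close>-tuple is a function restricted to \<open>{1..p}\<close>, so that equal tuples are equal functions.
\<close>

definition pair_profile ::
    "nat \<Rightarrow> (nat \<Rightarrow> 'a set) \<Rightarrow> 'a set \<Rightarrow> 'a set \<Rightarrow> (nat \<Rightarrow> nat) \<times> (nat \<Rightarrow> nat)" where
  "pair_profile p X T Y = (\<lambda>i\<in>{1..p}. card (T \<inter> X i), \<lambda>i\<in>{1..p}. card (Y \<inter> X i))"

text \<open>
  Integer arguments, because \<open>k\<^sub>i - a\<^sub>i - l\<^sub>i\<close> may be negative, in which case the
  coefficient has to vanish; truncated subtraction would give \<open>1\<close> instead.
\<close>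

definition int_binom :: "int \<Rightarrow> int \<Rightarrow> int" where
  "int_binom m l = (if l < 0 \<or> l > m then 0 else int (nat m choose nat l))"

definition cross_size ::
    "nat \<Rightarrow> (nat \<Rightarrow> nat) \<Rightarrow> (nat \<Rightarrow> nat) \<Rightarrow> (nat \<Rightarrow> nat) \<times> (nat \<Rightarrow> nat) \<Rightarrow> int" where
  "cross_size p n k = (\<lambda>(a, l).
     (\<Prod>i=1..p. int_binom (int (n i) - int (a i)) (int (k i) - int (a i)))
   - (\<Prod>i=1..p. int_binom (int (n i) - int (a i) - int (l i)) (int (k i) - int (a i)))
   + (\<Sum>i=1..p. int (a i)
        * int_binom (int (n i) - int (a i) - int (l i)) (int (k i) - int (a i) - int (l i) + 1)
        * (\<Prod>j\<in>{1..p} - {i}.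
             int_binom (int (n j) - int (a j) - int (l j)) (int (k j) - int (a j) - int (l j)))))"

definition feasible_pair ::
    "nat \<Rightarrow> (nat \<Rightarrow> 'a set) \<Rightarrow> (nat \<Rightarrow> nat) \<Rightarrow> 'a set \<Rightarrow> 'a set \<Rightarrow> bool" where
  "feasible_pair p X k T Y \<longleftrightarrow>
     T \<subseteq> ground_set p X \<and> Y \<subseteq> ground_set p X \<and> T \<inter> Y = {} \<and>
     (\<forall>y\<in>Y. admissible_set p X k (T \<union> {y})) \<and>
     (\<exists>x\<in>T. admissible_set p X k ((T - {x}) \<union> Y))"

text \<open>
  Equations and inequalities between differences such as \<open>l\<^sub>i \<le> k\<^sub>i - a\<^sub>i\<close> are written
  additively, to avoid truncated subtraction.
\<close>

definition extremal_shape ::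
    "nat \<Rightarrow> (nat \<Rightarrow> nat) \<Rightarrow> (nat \<Rightarrow> nat) \<Rightarrow> (nat \<Rightarrow> nat) \<Rightarrow> bool" where
  "extremal_shape p k a l \<longleftrightarrow>
     (\<Sum>i=1..p. l i) = 2
   \<or> (\<Sum>i=1..p. l i) \<ge> 3 \<and> (\<forall>i\<in>{1..p}. (l i = 0 \<or> l i = k i) \<and> a i + l i \<le> k i)
   \<or> (\<Sum>i=1..p. l i) \<ge> 3 \<and>
     (\<exists>!h. h \<in> {1..p} \<and> 1 \<le> a h \<and> a h + 1 \<le> k h \<and> a h + l h = k h + 1 \<and>
        (\<forall>i\<in>{1..p} - {h}. l i = 0 \<or> a i + l i = k i))"

definition extremal_profiles ::
    "nat \<Rightarrow> (nat \<Rightarrow> 'a set) \<Rightarrow> (nat \<Rightarrow> nat) \<Rightarrow> nat \<Rightarrow> ((nat \<Rightarrow> nat) \<times> (nat \<Rightarrow> nat)) set" where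
  "extremal_profiles p X k t =
     {(a, l). extremal_shape p k a l \<and>
        (\<exists>T Y. feasible_pair p X k T Y \<and> card T = t \<and> (a, l) = pair_profile p X T Y)}"

text \<open>Only used for \<open>K \<ge> t + 2\<close>, where the natural-number subtraction is exact.\<close>

definition Lambda_bound :: "nat \<Rightarrow> nat \<Rightarrow> nat" where
  "Lambda_bound K t = max (3 * t^2 * (K - t + 1)^2) (2 * (t + 1) * (K - t + 1)^3)"

end

theory Submission
  imports Defs
begin

text \<open>
  Call \<open>S\<close> a cover of \<open>\<F>\<close> if every member of \<open>\<F>\<close> meets \<open>S\<close> in at least \<open>t\<close> points. If \<open>A\<close> is not a
  cover, then the members containing \<open>A\<close> can be distributed over at most \<open>K - t + 1\<close> points outside
  \<open>A\<close> (on average), while adding a point to a set divides the number of members of the full family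
  containing it by more than \<open>1 + \<Lambda>\<close>. Take \<open>\<F>\<close> maximal. Then the admissible covers of size \<open>t + 1\<close>
  pairwise intersect in \<open>t\<close> points. If there is none, or only one, branching shows that \<open>\<F>\<close> is
  smaller than some cross family. If two of them meet in \<open>T\<close> and a third one does not contain \<open>T\<close>,
  then \<open>\<F>\<close> lies in a cross family with two-point \<open>Y\<close>. Otherwise all are of the form \<open>T \<union> {y}\<close> with
  \<open>y \<in> Y\<close>, and \<open>\<F>\<close> lies in the cross family of \<open>(T, Y)\<close>, unless some member contains \<open>T\<close> and avoids
  \<open>Y\<close>; in that case the surplus over the members through \<open>T\<close> and \<open>Y\<close> is small compared with the
  corresponding surplus of the cross family of \<open>(T, Y)\<close> or of \<open>(T, Y \<union> {y'})\<close> for some \<open>y'\<close>.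

  Hence the maximum is attained exactly by the largest cross families. Such a family with
  \<open>card Y \<ge> 3\<close> cannot be enlarged inside a block already met by \<open>Y\<close>, which forces its profile into
  the extremal shapes.
\<close>

section \<open>Counting members with a prescribed trace\<close>

locale finite_blocks =
  fixes p :: nat and k n :: "nat \<Rightarrow> nat" and X :: "nat \<Rightarrow> 'a set"
  assumes finite_block: "\<And>i. i \<in> {1..p} \<Longrightarrow> finite (X i)"
    and disjoint_blocks: "disjoint_family_on X {1..p}"
    and card_block: "\<And>i. i \<in> {1..p} \<Longrightarrow> card (X i) = n i"
begin

abbreviation G :: "'a set" where "G \<equiv> ground_set p X"
abbreviation H :: "'a set set" where "H \<equiv> block_family p X k"
abbreviation adm :: "'a set \<Rightarrow> bool" where "adm \<equiv> admissible_set p X k"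

text \<open>Two arguments serve both kinds of count: \<open>deg S S\<close> counts the members
  through \<open>S\<close> (see \<open>deg_self\<close>), while \<open>deg U V\<close> with
  \<open>V\<close> a proper part of \<open>U\<close> also prescribes points to be avoided.\<close>

definition deg :: "'a set \<Rightarrow> 'a set \<Rightarrow> nat" where
  "deg U V = card {F \<in> H. F \<inter> U = V}"

lemma finite_ground: "finite G"
  by (auto simp: ground_set_def finite_block)

lemma finite_sub_ground: "S \<subseteq> G \<Longrightarrow> finite S"
  by (rule finite_subset[OF _ finite_ground])

lemma finite_H: "finite H"
  by (rule finite_subset[of _ "Pow G"]) (auto simp: block_family_def finite_ground)

lemma block_eq: "i \<in> {1..p} \<Longrightarrow> j \<in> {1..p} \<Longrightarrow> x \<in> X i \<Longrightarrow> x \<in> X j \<Longrightarrow> i = j"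
  using disjoint_family_onD[OF disjoint_blocks, of i j] by blast

lemma block_sub: "i \<in> {1..p} \<Longrightarrow> X i \<subseteq> G"
  by (auto simp: ground_set_def)

lemma card_split_blocks:
  assumes "S \<subseteq> G"
  shows "card S = (\<Sum>i=1..p. card (S \<inter> X i))"
proof -
  have "S = (\<Union>i\<in>{1..p}. S \<inter> X i)" using assms by (auto simp: ground_set_def)
  then have "card S = card (\<Union>i\<in>{1..p}. S \<inter> X i)" by simp
  also have "\<dots> = (\<Sum>i\<in>{1..p}. card (S \<inter> X i))"
    by (rule card_UN_disjoint) (use disjoint_blocks finite_block in \<open>auto simp: disjoint_family_on_def\<close>)
  finally show ?thesis .
qed

lemma card_member: "F \<in> H \<Longrightarrow> card F = (\<Sum>i=1..p. k i)"
  using card_split_blocks[of F] by (simp add: block_family_def)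

lemma member_sub: "F \<in> H \<Longrightarrow> F \<subseteq> G"
  by (auto simp: block_family_def)

lemma finite_member: "F \<in> H \<Longrightarrow> finite F"
  by (rule finite_sub_ground[OF member_sub])

lemma adm_subset_member:
  assumes "F \<in> H" "S \<subseteq> F"
  shows "adm S"
proof -
  have "card (S \<inter> X i) \<le> k i" if "i \<in> {1..p}" for i
  proof -
    have "card (S \<inter> X i) \<le> card (F \<inter> X i)"
      using assms that finite_block by (intro card_mono) auto
    then show ?thesis using assms that by (auto simp: block_family_def)
  qed
  then show ?thesis using assms by (auto simp: admissible_set_def block_family_def)
qed

lemma adm_subset:
  assumes "adm W" "S \<subseteq> W"
  shows "adm S"
proof -
  have "card (S \<inter> X i) \<le> k i" if "i \<in> {1..p}" for i
  proof -
    have "card (S \<inter> X i) \<le> card (W \<inter> X i)"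
      using assms that finite_block by (intro card_mono) auto
    also have "\<dots> \<le> k i" using assms(1) that unfolding admissible_set_def by blast
    finally show ?thesis .
  qed
  then show ?thesis using assms by (auto simp: admissible_set_def)
qed

lemma adm_card: "adm S \<Longrightarrow> card S \<le> (\<Sum>i=1..p. k i)"
  using card_split_blocks[of S] sum_mono[of "{1..p}" "\<lambda>i. card (S \<inter> X i)" k]
  by (simp add: admissible_set_def)

text \<open>A subset of the ground set amounts to the tuple of its traces on the blocks, so
  blockwise conditions give a product. Disjointness of the blocks makes the union of a tuple an
  inverse of the trace map.\<close>

lemma card_blockwise:
  "card {F. F \<subseteq> G \<and> (\<forall>i\<in>{1..p}. P i (F \<inter> X i))} = (\<Prod>i=1..p. card {A. A \<subseteq> X i \<and> P i A})"
proof -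
  let ?L = "{F. F \<subseteq> G \<and> (\<forall>i\<in>{1..p}. P i (F \<inter> X i))}"
  let ?P = "PiE {1..p} (\<lambda>i. {A. A \<subseteq> X i \<and> P i A})"
  let ?f = "\<lambda>F. \<lambda>i\<in>{1..p}. F \<inter> X i" and ?g = "\<lambda>h. \<Union>i\<in>{1..p}. h i"
  have g: "?g h \<inter> X i = h i" if h: "h \<in> ?P" and i: "i \<in> {1..p}" for h i
  proof
    show "h i \<subseteq> ?g h \<inter> X i" using PiE_mem[OF h i] i by blast
    show "?g h \<inter> X i \<subseteq> h i"
    proof
      fix x assume "x \<in> ?g h \<inter> X i"
      then obtain j where j: "j \<in> {1..p}" "x \<in> h j" "x \<in> X i" by blast
      then have "x \<in> X j" using PiE_mem[OF h j(1)] by auto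
      then have "i = j" by (rule block_eq[OF i j(1) j(3)])
      then show "x \<in> h i" using j by simp
    qed
  qed
  have "bij_betw ?f ?L ?P"
  proof (rule bij_betw_byWitness[where f' = ?g])
    show "\<forall>F\<in>?L. ?g (?f F) = F" by (auto simp: ground_set_def)
    show "\<forall>h\<in>?P. ?f (?g h) = h"
    proof
      fix h assume h: "h \<in> ?P"
      show "?f (?g h) = h"
      proof
        fix i show "?f (?g h) i = h i"
          using g[OF h, of i] PiE_arb[OF h, of i] by (cases "i \<in> {1..p}") auto
      qed
    qed
    show "?f ` ?L \<subseteq> ?P" by auto
    show "?g ` ?P \<subseteq> ?L"
    proof
      fix F assume "F \<in> ?g ` ?P"
      then obtain h where h: "h \<in> ?P" "F = ?g h" by blast
      have "F \<subseteq> G" using h(2) PiE_mem[OF h(1)] block_sub by blast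
      moreover have "P i (F \<inter> X i)" if "i \<in> {1..p}" for i
        using g[OF h(1) that] PiE_mem[OF h(1) that] h(2) by simp
      ultimately show "F \<in> ?L" by blast
    qed
  qed
  then have "card ?L = card ?P" by (rule bij_betw_same_card)
  also have "\<dots> = (\<Prod>i=1..p. card {A. A \<subseteq> X i \<and> P i A})" by (simp add: card_PiE)
  finally show ?thesis .
qed

end

text \<open>Deleting \<open>U\<close> from \<open>B\<close> is a bijection onto the subsets of
  \<open>A - U\<close> with \<open>m - card V\<close> elements. With \<open>int_binom\<close> the
  formula also covers \<open>card V > m\<close>, where both sides vanish.\<close>

lemma card_subsets_trace:
  assumes "finite A" "U \<subseteq> A" "V \<subseteq> U"
  shows "int (card {B. B \<subseteq> A \<and> card B = m \<and> B \<inter> U = V}) =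
    int_binom (int (card A) - int (card U)) (int m - int (card V))"
proof -
  have fin: "finite U" "finite V"
    using finite_subset[OF assms(2,1)] finite_subset[OF assms(3)] by auto
  let ?L = "{B. B \<subseteq> A \<and> card B = m \<and> B \<inter> U = V}"
  have decomp: "card B = card V + card (B - U)" if "B \<subseteq> A" "B \<inter> U = V" for B
    using card_Int_Diff[of B U] that finite_subset[OF that(1) assms(1)] by simp
  show ?thesis
  proof (cases "card V \<le> m")
    case False
    then have "\<not> (B \<subseteq> A \<and> card B = m \<and> B \<inter> U = V)" for B using decomp[of B] by linarith
    then have "?L = {}" by blast
    then have "card ?L = 0" by (simp only: card.empty)
    then show ?thesis using False by (simp add: int_binom_def)
  next
    case True
    have "bij_betw (\<lambda>B. B - U) ?L {C. C \<subseteq> A - U \<and> card C = m - card V}"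
    proof (rule bij_betw_byWitness[where f' = "\<lambda>C. C \<union> V"])
      show "\<forall>B\<in>?L. B - U \<union> V = B" by blast
      show "\<forall>C\<in>{C. C \<subseteq> A - U \<and> card C = m - card V}. C \<union> V - U = C" using assms(3) by blast
      show "(\<lambda>B. B - U) ` ?L \<subseteq> {C. C \<subseteq> A - U \<and> card C = m - card V}"
      proof (rule image_subsetI)
        fix B assume "B \<in> ?L"
        then have B: "B \<subseteq> A" "card B = m" "B \<inter> U = V" by simp_all
        then have "card (B - U) = m - card V" using decomp[OF B(1,3)] by linarith
        then show "B - U \<in> {C. C \<subseteq> A - U \<and> card C = m - card V}" using B(1) by blast
      qed
      show "(\<lambda>C. C \<union> V) ` {C. C \<subseteq> A - U \<and> card C = m - card V} \<subseteq> ?L"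
      proof (rule image_subsetI)
        fix C assume "C \<in> {C. C \<subseteq> A - U \<and> card C = m - card V}"
        then have C: "C \<subseteq> A - U" "card C = m - card V" by simp_all
        have "finite C" using finite_subset[OF C(1)] assms(1) by simp
        moreover have "C \<inter> V = {}" using C(1) assms(3) by blast
        ultimately have "card (C \<union> V) = m" using C(2) fin(2) True by (simp add: card_Un_disjoint)
        moreover have "C \<union> V \<subseteq> A" "(C \<union> V) \<inter> U = V" using C(1) assms(2,3) by blast+
        ultimately show "C \<union> V \<in> ?L" by simp
      qed
    qed
    then have "card ?L = card {C. C \<subseteq> A - U \<and> card C = m - card V}" by (rule bij_betw_same_card)
    also have "\<dots> = card (A - U) choose (m - card V)" using assms by (simp add: n_subsets)
    also have "card (A - U) = card A - card U" using assms fin by (simp add: card_Diff_subset)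
    finally have eq: "card ?L = (card A - card U) choose (m - card V)" .
    have le: "card U \<le> card A" using assms by (simp add: card_mono)
    have n1: "nat (int (card A) - int (card U)) = card A - card U"
      and n2: "nat (int m - int (card V)) = m - card V" using le True by auto
    show ?thesis unfolding int_binom_def n1 n2 eq using le True
      by (auto simp: binomial_eq_0_iff)
  qed
qed

text \<open>Outside the range from \<open>0 < l\<close> to \<open>l \<le> m\<close> both sides
  vanish, so the absorption identity holds for all integers and \<open>deg_insert\<close> needs no
  admissibility.\<close>

lemma int_binom_absorb: "m * int_binom (m - 1) (l - 1) = l * int_binom m l"
proof (cases "0 < l \<and> l \<le> m")
  case True
  then obtain a b where ab: "m = int (Suc a)" "l = int (Suc b)" "b \<le> a"
    using that[of "nat m - 1" "nat l - 1"] by linarith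
  have "int (Suc a) * int (a choose b) = int (Suc b) * int (Suc a choose Suc b)"
    unfolding of_nat_mult[symmetric] Suc_times_binomial_eq by (simp only: mult.commute)
  moreover have "int_binom m l = int (Suc a choose Suc b)" "int_binom (m - 1) (l - 1) = int (a choose b)"
    using ab by (auto simp: int_binom_def nat_add_distrib simp del: binomial_Suc_Suc)
  ultimately show ?thesis using ab by simp
next
  case False
  then show ?thesis by (auto simp: int_binom_def)
qed

lemma int_binom_pos: "0 \<le> l \<Longrightarrow> l \<le> m \<Longrightarrow> 0 < int_binom m l"
  by (auto simp: int_binom_def nat_le_eq_zle)

context finite_blocks
begin

text \<open>The requirement on the trace splits over the blocks, so \<open>card_blockwise\<close>
  reduces the count to \<open>card_subsets_trace\<close> in each block.\<close>

lemma deg_formula: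
  assumes "U \<subseteq> G" "V \<subseteq> U"
  shows "int (deg U V) = (\<Prod>i=1..p. int_binom (int (n i) - int (card (U \<inter> X i))) (int (k i) - int (card (V \<inter> X i))))"
proof -
  have "(F \<inter> U = V) \<longleftrightarrow> (\<forall>i\<in>{1..p}. (F \<inter> X i) \<inter> (U \<inter> X i) = V \<inter> X i)" if "F \<subseteq> G" for F
  proof
    assume r: "\<forall>i\<in>{1..p}. (F \<inter> X i) \<inter> (U \<inter> X i) = V \<inter> X i"
    have "x \<in> F \<inter> U \<longleftrightarrow> x \<in> V" for x
    proof (cases "x \<in> G")
      case True
      then obtain i where "i \<in> {1..p}" "x \<in> X i" by (auto simp: ground_set_def)
      then show ?thesis using r by blast
    next
      case False then show ?thesis using assms by blast
    qed
    then show "F \<inter> U = V" by blast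
  qed auto
  note trace = this
  have "{F \<in> H. F \<inter> U = V} = {F. F \<subseteq> G \<and> (\<forall>i\<in>{1..p}. card (F \<inter> X i) = k i \<and>
      (F \<inter> X i) \<inter> (U \<inter> X i) = V \<inter> X i)}"
    unfolding block_family_def mem_Collect_eq ball_conj_distrib using trace by (intro Collect_cong) metis
  then have "deg U V = (\<Prod>i=1..p. card {A. A \<subseteq> X i \<and> (card A = k i \<and> A \<inter> (U \<inter> X i) = V \<inter> X i)})"
    unfolding deg_def by (simp only: card_blockwise[where P = "\<lambda>i A. card A = k i \<and> A \<inter> (U \<inter> X i) = V \<inter> X i"])
  then have "int (deg U V) = (\<Prod>i=1..p. int (card {A. A \<subseteq> X i \<and> (card A = k i \<and> A \<inter> (U \<inter> X i) = V \<inter> X i)}))"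
    by simp
  also have "\<dots> = (\<Prod>i=1..p. int_binom (int (n i) - int (card (U \<inter> X i))) (int (k i) - int (card (V \<inter> X i))))"
  proof (rule prod.cong[OF refl])
    fix i assume "i \<in> {1..p}"
    then show "int (card {A. A \<subseteq> X i \<and> (card A = k i \<and> A \<inter> (U \<inter> X i) = V \<inter> X i)}) =
       int_binom (int (n i) - int (card (U \<inter> X i))) (int (k i) - int (card (V \<inter> X i)))"
      using card_subsets_trace[of "X i" "U \<inter> X i" "V \<inter> X i" "k i"] finite_block card_block assms by auto
  qed
  finally show ?thesis .
qed

lemma card_insert_block:
  assumes "i \<in> {1..p}" "y \<in> X i" "y \<notin> S" "S \<subseteq> G" "j \<in> {1..p}"
  shows "card (insert y S \<inter> X j) = card (S \<inter> X j) + (if j = i then 1 else 0)"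
proof (cases "j = i")
  case True
  then have "insert y S \<inter> X j = insert y (S \<inter> X j)" using assms by blast
  moreover have "finite (S \<inter> X j)" using assms(4) finite_sub_ground by blast
  moreover have "y \<notin> S \<inter> X j" using assms(3) by blast
  ultimately show ?thesis using True by (simp only: card_insert_disjoint) simp
next
  case False
  then have "y \<notin> X j" using block_eq[OF assms(1,5,2)] by blast
  then have "insert y S \<inter> X j = S \<inter> X j" by blast
  then show ?thesis using False by simp
qed

text \<open>Only the factor of block \<open>i\<close> changes, and absorption compares its two
  values. This identity, free of division, is the source of all degree ratios below.\<close>

lemma deg_insert:
  assumes "i \<in> {1..p}" "y \<in> X i" "y \<notin> U" "U \<subseteq> G" "V \<subseteq> U"
  shows "(int (n i) - int (card (U \<inter> X i))) * int (deg (insert y U) (insert y V)) =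
    (int (k i) - int (card (V \<inter> X i))) * int (deg U V)"
proof -
  let ?b = "\<lambda>U V i. int_binom (int (n i) - int (card (U \<inter> X i))) (int (k i) - int (card (V \<inter> X i)))"
  have iG: "insert y U \<subseteq> G" using assms(4) assms(2) block_sub[OF assms(1)] by blast
  have iV: "insert y V \<subseteq> insert y U" using assms(5) by blast
  have yV: "y \<notin> V" "V \<subseteq> G" using assms by auto
  note cU = card_insert_block[OF assms(1,2,3,4)] and cV = card_insert_block[OF assms(1,2) yV]
  have e1: "int (deg (insert y U) (insert y V)) = ?b (insert y U) (insert y V) i *
      (\<Prod>j\<in>{1..p}-{i}. ?b (insert y U) (insert y V) j)"
    unfolding deg_formula[OF iG iV] by (rule prod.remove) (use assms(1) in auto)
  have e2: "int (deg U V) = ?b U V i * (\<Prod>j\<in>{1..p}-{i}. ?b U V j)"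
    unfolding deg_formula[OF assms(4,5)] by (rule prod.remove) (use assms(1) in auto)
  have e3: "(\<Prod>j\<in>{1..p}-{i}. ?b (insert y U) (insert y V) j) = (\<Prod>j\<in>{1..p}-{i}. ?b U V j)"
    by (rule prod.cong[OF refl]) (simp add: cU cV)
  have "?b (insert y U) (insert y V) i =
    int_binom (int (n i) - int (card (U \<inter> X i)) - 1) (int (k i) - int (card (V \<inter> X i)) - 1)"
    using cU[OF assms(1)] cV[OF assms(1)] by (simp add: algebra_simps)
  then show ?thesis unfolding e1 e2 e3
    by (simp only: mult.assoc[symmetric] int_binom_absorb)
qed

text \<open>Degrees depend on profiles only, which allows exchanging points of one block.\<close>

lemma deg_cong_profile:
  assumes "U \<subseteq> G" "V \<subseteq> U" "U' \<subseteq> G" "V' \<subseteq> U'"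
    and "\<And>i. i \<in> {1..p} \<Longrightarrow> card (U \<inter> X i) = card (U' \<inter> X i)"
    and "\<And>i. i \<in> {1..p} \<Longrightarrow> card (V \<inter> X i) = card (V' \<inter> X i)"
  shows "deg U V = deg U' V'"
proof -
  have "int (deg U V) = int (deg U' V')"
    unfolding deg_formula[OF assms(1,2)] deg_formula[OF assms(3,4)]
    by (rule prod.cong[OF refl]) (use assms(5,6) in auto)
  then show ?thesis by simp
qed

lemma deg_split:
  assumes "y \<notin> U" "V \<subseteq> U"
  shows "deg U V = deg (insert y U) (insert y V) + deg (insert y U) V"
proof -
  have "{F \<in> H. F \<inter> U = V} = {F \<in> H. F \<inter> insert y U = insert y V} \<union> {F \<in> H. F \<inter> insert y U = V}"
    using assms by auto
  moreover have "{F \<in> H. F \<inter> insert y U = insert y V} \<inter> {F \<in> H. F \<inter> insert y U = V} = {}"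
    using assms by auto
  ultimately show ?thesis unfolding deg_def using finite_H by (simp add: card_Un_disjoint)
qed

end

section \<open>Numerical consequences of large blocks and degree ratios\<close>

locale large_blocks = finite_blocks +
  fixes t K :: nat
  assumes t_pos: "1 \<le> t"
    and K_def: "K = (\<Sum>i=1..p. k i)"
    and K_ge: "t + 2 \<le> K"
    and n_large: "\<And>i. i \<in> {1..p} \<Longrightarrow> K * (1 + Lambda_bound K t) < n i"
begin

abbreviation L :: nat where "L \<equiv> Lambda_bound K t"

text \<open>A member that meets a set in exactly \<open>t - 1\<close> points has \<open>c\<close>
  points outside it; \<open>c\<close> is the branching factor.\<close>

definition c :: nat where "c = K - t + 1"

lemma c_ge: "3 \<le> c"
  using K_ge by (simp add: c_def)

text \<open>Of the two terms of the maximum, this one pays for the base case of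
  \<open>binomial_growth\<close>; the other one yields the further numerical bounds below.\<close>

lemma L_ge1: "3 * t\<^sup>2 * c\<^sup>2 \<le> L"
  by (simp add: Lambda_bound_def c_def)

lemma L_ge2: "2 * (t + 1) * c ^ 3 \<le> L"
  by (simp add: Lambda_bound_def c_def)

lemma L_ge3: "2 * (t + 1) * c\<^sup>2 * 3 \<le> L"
proof -
  have "2 * (t + 1) * c\<^sup>2 * 3 \<le> 2 * (t + 1) * c\<^sup>2 * c" using c_ge by (intro mult_left_mono) auto
  also have "\<dots> = 2 * (t + 1) * c ^ 3" by (simp add: power2_eq_square power3_eq_cube algebra_simps)
  finally show ?thesis using L_ge2 by linarith
qed

lemma L_ge4: "18 * (t + 1) * c \<le> L"
proof -
  have "6 * (t + 1) * c * 3 \<le> 6 * (t + 1) * c * c" using c_ge by (intro mult_left_mono) auto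
  then show ?thesis using L_ge3 by (simp add: power2_eq_square algebra_simps)
qed

lemma L_ge5: "12 * c\<^sup>2 \<le> L"
proof -
  have "2 * 2 * c\<^sup>2 * 3 \<le> 2 * (t + 1) * c\<^sup>2 * 3" using t_pos by (intro mult_right_mono mult_left_mono) auto
  then show ?thesis using L_ge3 by linarith
qed

lemma L_ge_c: "36 * c \<le> L" and L_ge: "108 \<le> L"
proof -
  have "18 * 2 * c \<le> 18 * (t + 1) * c" using t_pos by (intro mult_right_mono mult_left_mono) auto
  then show "36 * c \<le> L" using L_ge4 by linarith
  then show "108 \<le> L" using c_ge by linarith
qed

lemma k_le_K: "i \<in> {1..p} \<Longrightarrow> k i \<le> K"
  unfolding K_def by (rule member_le_sum) auto

lemma card_member_K: "F \<in> H \<Longrightarrow> card F = K"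
  by (simp add: card_member K_def)

lemma adm_card_K: "adm S \<Longrightarrow> card S \<le> K"
  using adm_card K_def by simp

lemma adm_sub: "adm S \<Longrightarrow> S \<subseteq> G"
  by (simp add: admissible_set_def)

lemma card_trace_le: "S \<subseteq> G \<Longrightarrow> card (S \<inter> X i) \<le> card S"
  by (rule card_mono) (auto simp: finite_sub_ground)

text \<open>Every factor is a binomial coefficient within range, because \<open>n i\<close> exceeds
  \<open>3 * K\<close>, enough for \<open>k i\<close> plus the points of \<open>U\<close>. The bound
  \<open>2 * K\<close> accommodates a union of two admissible sets.\<close>

lemma deg_pos:
  assumes "U \<subseteq> G" "V \<subseteq> U" "adm V" "card U \<le> 2 * K"
  shows "0 < deg U V"
proof -
  have "0 < int (deg U V)"
    unfolding deg_formula[OF assms(1,2)]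
  proof (rule prod_pos, rule int_binom_pos)
    fix i assume i: "i \<in> {1..p}"
    show "0 \<le> int (k i) - int (card (V \<inter> X i))" using assms(3) i by (simp add: admissible_set_def)
    have "K * 3 \<le> K * (1 + L)" using L_ge by (intro mult_left_mono) auto
    then show "int (k i) - int (card (V \<inter> X i)) \<le> int (n i) - int (card (U \<inter> X i))"
      using n_large[OF i] k_le_K[OF i] card_trace_le[OF assms(1), of i] assms(4) by linarith
  qed
  then show ?thesis by simp
qed

lemma deg_eq_0: "\<not> adm V \<Longrightarrow> V \<subseteq> U \<Longrightarrow> deg U V = 0"
  unfolding deg_def using adm_subset_member[of _ V]
  by (metis (mono_tags, lifting) Int_lower1 card.empty empty_Collect_eq)

text \<open>By \<open>deg_insert\<close> the quotient of the degrees is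
  \<open>n i - card (U \<inter> X i)\<close> over \<open>k i - card (V \<inter> X i)\<close>; the
  hypothesis on \<open>r\<close> bounds it below with \<open>K\<close> in place of
  \<open>k i\<close>.\<close>

lemma deg_ratio:
  assumes "i \<in> {1..p}" "y \<in> X i" "y \<notin> U" "U \<subseteq> G" "V \<subseteq> U"
    and r: "r * (K - card (V \<inter> X i)) + card (U \<inter> X i) \<le> n i"
  shows "r * deg (insert y U) (insert y V) \<le> deg U V"
proof -
  let ?d' = "int (deg (insert y U) (insert y V))" and ?d = "int (deg U V)"
  let ?u = "int (card (U \<inter> X i))" and ?v = "int (card (V \<inter> X i))"
  have eq: "(int (n i) - ?u) * ?d' = (int (k i) - ?v) * ?d" by (rule deg_insert[OF assms(1-5)])
  have "U \<inter> X i \<subset> X i" using assms by blast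
  then have un: "?u < int (n i)" using psubset_card_mono[of "X i"] finite_block card_block assms(1) by auto
  show ?thesis
  proof (cases "?d' = 0")
    case True then show ?thesis by simp
  next
    case False
    \<comment> \<open>A nonzero degree shows that block \<open>i\<close> has room for
      \<open>y\<close>, so the common factor can be cancelled.\<close>
    then have "0 < (int (n i) - ?u) * ?d'" using un by simp
    then have "0 < (int (k i) - ?v) * ?d" using eq by simp
    then have kv: "0 < int (k i) - ?v" by (simp add: zero_less_mult_iff)
    have "int r * (int (k i) - ?v) \<le> int r * int (K - card (V \<inter> X i))"
      using k_le_K[OF assms(1)] by (intro mult_left_mono) auto
    also have "\<dots> \<le> int (n i) - ?u" using r by (simp flip: of_nat_mult of_nat_add)
    finally have "int r * (int (k i) - ?v) * ?d' \<le> (int (n i) - ?u) * ?d'" by (rule mult_right_mono) simp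
    then have "(int (k i) - ?v) * (int r * ?d') \<le> (int (k i) - ?v) * ?d" using eq by (simp add: algebra_simps)
    then have "int r * ?d' \<le> ?d" using kv by (simp only: mult_le_cancel_left_pos)
    then show ?thesis by (simp flip: of_nat_mult)
  qed
qed

text \<open>The factor drops from \<open>1 + L\<close> to \<open>L - 1\<close> in order to absorb up
  to \<open>2 * K\<close> points of \<open>U\<close>.\<close>

lemma deg_ratio_general:
  assumes "y \<in> G" "y \<notin> U" "U \<subseteq> G" "V \<subseteq> U" "card U \<le> 2 * K"
  shows "(L - 1) * deg (insert y U) (insert y V) \<le> deg U V"
proof -
  obtain i where i: "i \<in> {1..p}" "y \<in> X i" using assms(1) by (auto simp: ground_set_def)
  have "(L - 1) * (K - card (V \<inter> X i)) + card (U \<inter> X i) \<le> (L - 1) * K + 2 * K"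
    using card_trace_le[OF assms(3), of i] assms(5) by (intro add_mono mult_left_mono) auto
  also have "\<dots> = K * (1 + L)" using L_ge by (cases L) (auto simp: algebra_simps)
  finally show ?thesis using n_large[OF i(1)] by (intro deg_ratio[OF i assms(2-4)]) simp
qed

text \<open>With equal arguments the points of \<open>S\<close> in the block reduce numerator and
  denominator alike, which keeps the full factor \<open>1 + L\<close>.\<close>

lemma deg_ratio_self:
  assumes "y \<in> G" "y \<notin> S" "S \<subseteq> G"
  shows "(1 + L) * deg (insert y S) (insert y S) \<le> deg S S"
proof (cases "adm (insert y S)")
  case False
  then show ?thesis using deg_eq_0 by simp
next
  case True
  obtain i where i: "i \<in> {1..p}" "y \<in> X i" using assms(1) by (auto simp: ground_set_def)
  let ?s = "card (S \<inter> X i)"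
  have "?s \<le> K" using card_trace_le[OF assms(3), of i] adm_card_K[OF adm_subset[OF True subset_insertI]] by linarith
  then have "(1 + L) * (K - ?s) + ?s \<le> (1 + L) * (K - ?s) + (1 + L) * ?s" by simp
  also have "\<dots> = K * (1 + L)" using \<open>?s \<le> K\<close> by (simp only: add_mult_distrib2[symmetric]) simp
  finally show ?thesis using n_large[OF i(1)] by (intro deg_ratio[OF i assms(2,3)]) auto
qed

lemma deg_self_chain:
  assumes "W \<subseteq> G" "S \<subseteq> W"
  shows "(1 + L) ^ card (W - S) * deg W W \<le> deg S S"
proof -
  have fW: "finite W" using assms finite_sub_ground by blast
  have "finite D \<Longrightarrow> D \<subseteq> G \<Longrightarrow> D \<inter> S = {} \<Longrightarrow> (1 + L) ^ card D * deg (S \<union> D) (S \<union> D) \<le> deg S S" for D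
  proof (induction D rule: finite_induct)
    case (insert y D)
    have "(1 + L) * deg (insert y (S \<union> D)) (insert y (S \<union> D)) \<le> deg (S \<union> D) (S \<union> D)"
      by (rule deg_ratio_self) (use insert assms in auto)
    then have "(1 + L) ^ card D * ((1 + L) * deg (insert y (S \<union> D)) (insert y (S \<union> D)))
        \<le> (1 + L) ^ card D * deg (S \<union> D) (S \<union> D)" by (rule mult_left_mono) simp
    also have "\<dots> \<le> deg S S" using insert by auto
    finally show ?case using insert by (simp add: algebra_simps)
  qed simp
  moreover have "S \<union> (W - S) = W" "W - S \<subseteq> G" "(W - S) \<inter> S = {}" "finite (W - S)"
    using assms fW by auto
  ultimately show ?thesis by metis
qed

lemma deg_self_ratio:
  assumes "W \<subseteq> G" "S \<subset> W"
  shows "(1 + L) * deg W W \<le> deg S S"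
proof -
  have fW: "finite W" using assms finite_sub_ground by blast
  have "W - S \<noteq> {}" using assms by blast
  then have "1 \<le> card (W - S)" using fW by (simp add: Suc_le_eq card_gt_0_iff)
  then have "(1 + L) ^ 1 \<le> (1 + L) ^ card (W - S)" by (intro power_increasing) auto
  then have "(1 + L) ^ 1 * deg W W \<le> (1 + L) ^ card (W - S) * deg W W" by (rule mult_right_mono) simp
  also have "\<dots> \<le> deg S S" using assms by (intro deg_self_chain) auto
  finally show ?thesis by simp
qed

lemma deg_self: "deg S S = card {F \<in> H. S \<subseteq> F}"
  unfolding deg_def by (rule arg_cong[where f = card]) auto

lemma card_le_deg_self:
  assumes "\<G> \<subseteq> H" "\<And>F. F \<in> \<G> \<Longrightarrow> S \<subseteq> F"
  shows "card \<G> \<le> deg S S"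
  unfolding deg_self by (rule card_mono) (use assms finite_H in auto)

section \<open>Covers and branching\<close>

definition cover :: "'a set set \<Rightarrow> 'a set \<Rightarrow> bool" where
  "cover \<F> S \<longleftrightarrow> (\<forall>F\<in>\<F>. t \<le> card (S \<inter> F))"

lemma coverD: "cover \<F> S \<Longrightarrow> F \<in> \<F> \<Longrightarrow> t \<le> card (S \<inter> F)"
  by (simp add: cover_def)

lemma cover_mono: "cover \<F> S \<Longrightarrow> S \<subseteq> S' \<Longrightarrow> finite S' \<Longrightarrow> cover \<F> S'"
  unfolding cover_def by (meson Int_mono card_mono finite_Int le_trans subset_refl)

lemma member_cover: "t_intersecting t \<F> \<Longrightarrow> F \<in> \<F> \<Longrightarrow> cover \<F> F"
  by (simp add: cover_def t_intersecting_def)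

text \<open>Double counting the pairs of a member of \<open>\<G>\<close> and one of its elements in \<open>F' - A\<close>: with
  \<open>j = t - card (A \<inter> F')\<close> there are at least \<open>j\<close> such elements in every member and
  \<open>c - 1 + j \<le> c * j\<close> candidates.\<close>

lemma branch:
  assumes FH: "\<F> \<subseteq> H" and int: "t_intersecting t \<F>" and sub: "\<G> \<subseteq> \<F>"
    and A: "\<And>F. F \<in> \<G> \<Longrightarrow> A \<subseteq> F" and F': "F' \<in> \<F>" "card (A \<inter> F') < t"
  obtains y where "y \<in> F'" "y \<notin> A" "card \<G> \<le> c * card {F \<in> \<G>. y \<in> F}"
proof -
  define j where "j = t - card (A \<inter> F')"
  have fin: "finite F'" "finite \<G>"
    using finite_member[of F'] F'(1) FH finite_subset[OF sub finite_subset[OF FH finite_H]] by blast+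
  have j: "1 \<le> j" using F' by (simp add: j_def)
  have cardD: "card (F' - A) = c - 1 + j"
  proof -
    have "card (F' - A) = card F' - card (A \<inter> F')"
      using fin by (metis card_Diff_subset_Int Int_commute finite_Int)
    moreover have "card F' = K" using F' FH by (auto simp: card_member_K)
    ultimately show ?thesis using F' K_ge by (simp add: j_def c_def)
  qed
  have many: "j \<le> card (F \<inter> (F' - A))" if "F \<in> \<G>" for F
  proof -
    have "t \<le> card (F \<inter> F')" using int that sub F' by (auto simp: t_intersecting_def)
    also have "\<dots> \<le> card (A \<inter> F') + card (F \<inter> (F' - A))"
    proof -
      have "F \<inter> F' \<subseteq> (A \<inter> F') \<union> (F \<inter> (F' - A))" by blast
      then have "card (F \<inter> F') \<le> card ((A \<inter> F') \<union> (F \<inter> (F' - A)))" using fin by (intro card_mono) auto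
      also have "\<dots> \<le> card (A \<inter> F') + card (F \<inter> (F' - A))" by (rule card_Un_le)
      finally show ?thesis .
    qed
    finally show ?thesis by (simp add: j_def)
  qed
  have count: "(\<Sum>y\<in>F'-A. card {F \<in> \<G>. y \<in> F}) = (\<Sum>F\<in>\<G>. card (F \<inter> (F' - A)))"
  proof -
    have "card {F \<in> \<G>. y \<in> F} = (\<Sum>F\<in>\<G>. if y \<in> F then 1 else 0)" for y
      by (simp only: card_eq_sum sum.inter_filter[OF fin(2)])
    then have "(\<Sum>y\<in>F'-A. card {F \<in> \<G>. y \<in> F}) = (\<Sum>y\<in>F'-A. \<Sum>F\<in>\<G>. if y \<in> F then 1 else 0)"
      by simp
    also have "\<dots> = (\<Sum>F\<in>\<G>. \<Sum>y\<in>F'-A. if y \<in> F then 1 else 0)" by (rule sum.swap)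
    also have "\<dots> = (\<Sum>F\<in>\<G>. card (F \<inter> (F' - A)))"
    proof (rule sum.cong[OF refl])
      fix F
      have "F \<inter> (F' - A) = {y \<in> F' - A. y \<in> F}" by blast
      then have "card (F \<inter> (F' - A)) = card {y \<in> F' - A. y \<in> F}" by simp
      also have "\<dots> = (\<Sum>y\<in>F'-A. if y \<in> F then 1 else 0)"
        by (simp only: card_eq_sum sum.inter_filter[OF finite_Diff[OF fin(1)]])
      finally show "(\<Sum>y\<in>F'-A. if y \<in> F then 1 else 0) = card (F \<inter> (F' - A))" ..
    qed
    finally show ?thesis .
  qed
  note witness = that
  show ?thesis
  proof (rule ccontr)
    assume neg: "\<not> thesis"
    have less: "c * card {F \<in> \<G>. y \<in> F} < card \<G>" if "y \<in> F' - A" for y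
      using neg witness[of y] that by (meson DiffD1 DiffD2 not_le_imp_less)
    have ne: "F' - A \<noteq> {}" using cardD j by (metis add_is_0 card.empty not_one_le_zero)
    have "(\<Sum>F\<in>\<G>. j) \<le> (\<Sum>F\<in>\<G>. card (F \<inter> (F' - A)))" by (rule sum_mono[OF many])
    then have "c * (card \<G> * j) \<le> c * (\<Sum>F\<in>\<G>. card (F \<inter> (F' - A)))" by simp
    also have "\<dots> = (\<Sum>y\<in>F'-A. c * card {F \<in> \<G>. y \<in> F})" by (simp only: count[symmetric] sum_distrib_left)
    also have "\<dots> < (\<Sum>y\<in>F'-A. card \<G>)" by (rule sum_strict_mono) (use fin ne less in auto)
    also have "\<dots> = (c - 1 + j) * card \<G>" by (simp add: cardD)
    \<comment> \<open>Amounts to \<open>(c - 1) * (j - 1) \<ge> 0\<close>.\<close>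
    also have "\<dots> \<le> c * j * card \<G>"
    proof (rule mult_right_mono)
      obtain a b where "c = Suc a" "j = Suc b" using j c_ge by (cases c; cases j) auto
      then show "c - 1 + j \<le> c * j" by simp
    qed simp
    finally show False by (simp add: algebra_simps)
  qed
qed

text \<open>Iterates \<open>branch\<close>: a set too small to be a cover gains a point at the price
  of a factor \<open>c\<close>. The non-cover hypothesis concerns only sets between \<open>A\<close>
  and a member of \<open>\<G>\<close>, the only ones that arise.\<close>

lemma branch_iter:
  assumes FH: "\<F> \<subseteq> H" and int: "t_intersecting t \<F>"
    and "\<G> \<subseteq> \<F>" "\<And>F. F \<in> \<G> \<Longrightarrow> A \<subseteq> F" "\<G> \<noteq> {}" "card A \<le> m"
    and "\<And>B F. A \<subseteq> B \<Longrightarrow> F \<in> \<G> \<Longrightarrow> B \<subseteq> F \<Longrightarrow> card B < m \<Longrightarrow> \<not> cover \<F> B"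
  shows "\<exists>W F. A \<subseteq> W \<and> card W = m \<and> F \<in> \<G> \<and> W \<subseteq> F \<and> card \<G> \<le> c ^ (m - card A) * card {F \<in> \<G>. W \<subseteq> F}"
  using assms(3-)
proof (induction "m - card A" arbitrary: A \<G>)
  case 0
  then have "{F \<in> \<G>. A \<subseteq> F} = \<G>" by blast
  moreover obtain E where "E \<in> \<G>" using 0 by blast
  ultimately show ?case using 0 by (intro exI[of _ A] exI[of _ E]) auto
next
  case (Suc d)
  obtain F where F: "F \<in> \<G>" using Suc by blast
  have "card A < m" using Suc(2) by linarith
  then have "\<not> cover \<F> A" using Suc.prems(5)[OF order.refl F Suc.prems(2)[OF F]] by blast
  then obtain F' where F': "F' \<in> \<F>" "card (A \<inter> F') < t" by (auto simp: cover_def not_le)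
  obtain y where y: "y \<in> F'" "y \<notin> A" "card \<G> \<le> c * card {F \<in> \<G>. y \<in> F}"
    using branch[OF FH int Suc.prems(1) Suc.prems(2) F'] by blast
  have fin: "finite \<G>" using finite_subset[OF Suc.prems(1) finite_subset[OF FH finite_H]] .
  have "F \<in> H" using F Suc.prems(1) FH by blast
  then have finA: "finite A" using finite_subset[OF Suc.prems(2)[OF F]] finite_member by blast
  have cardA: "card (insert y A) = Suc (card A)" using y finA by simp
  let ?G = "{F \<in> \<G>. y \<in> F}"
  have "card \<G> \<noteq> 0" using Suc.prems(3) fin by simp
  \<comment> \<open>The estimate keeps the surviving subfamily nonempty, so the iteration can
    continue.\<close>
  then have ne: "?G \<noteq> {}" using y(3) by (metis card.empty le_zero_eq mult_0_right)
  have "\<exists>W F. insert y A \<subseteq> W \<and> card W = m \<and> F \<in> ?G \<and> W \<subseteq> F \<and>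
      card ?G \<le> c ^ (m - card (insert y A)) * card {F \<in> ?G. W \<subseteq> F}"
  proof (rule Suc.hyps(1))
    show "d = m - card (insert y A)" using Suc.hyps(2) cardA by simp
    show "?G \<subseteq> \<F>" using Suc.prems(1) by blast
    show "insert y A \<subseteq> F" if "F \<in> ?G" for F using that Suc.prems(2) by blast
    show "?G \<noteq> {}" by (rule ne)
    show "card (insert y A) \<le> m" using \<open>card A < m\<close> cardA by simp
    show "\<not> cover \<F> B" if "insert y A \<subseteq> B" "F \<in> ?G" "B \<subseteq> F" "card B < m" for B F
      using Suc.prems(5)[of B F] that by blast
  qed
  then obtain W E where W: "insert y A \<subseteq> W" "card W = m" "E \<in> ?G" "W \<subseteq> E"
      "card ?G \<le> c ^ (m - card (insert y A)) * card {F \<in> ?G. W \<subseteq> F}" by blast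
  have "{F \<in> ?G. W \<subseteq> F} = {F \<in> \<G>. W \<subseteq> F}" using W(1) by blast
  then have "c * card ?G \<le> c * (c ^ (m - card (insert y A)) * card {F \<in> \<G>. W \<subseteq> F})"
    using W(5) by (intro mult_left_mono) auto
  also have "\<dots> = c ^ (m - card A) * card {F \<in> \<G>. W \<subseteq> F}"
  proof -
    have "m - card A = Suc (m - card (insert y A))" using cardA \<open>card A < m\<close> by linarith
    then show ?thesis by (simp only: power_Suc mult.assoc)
  qed
  finally show ?case using W y(3) by (intro exI[of _ W] exI[of _ E]) auto
qed

text \<open>The member \<open>F\<close> above \<open>W\<close> is returned as well: it certifies
  that \<open>W\<close> is admissible and carries over whatever distinguishes
  \<open>\<G>\<close>.\<close>

lemma branch_iter_deg:
  assumes FH: "\<F> \<subseteq> H" and int: "t_intersecting t \<F>"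
    and sub: "\<G> \<subseteq> \<F>" and A: "\<And>F. F \<in> \<G> \<Longrightarrow> A \<subseteq> F" and "\<G> \<noteq> {}" "card A \<le> m"
    and non_cover: "\<And>B F. A \<subseteq> B \<Longrightarrow> F \<in> \<G> \<Longrightarrow> B \<subseteq> F \<Longrightarrow> card B < m \<Longrightarrow> \<not> cover \<F> B"
  obtains W F where "A \<subseteq> W" "card W = m" "F \<in> \<G>" "W \<subseteq> F" "card \<G> \<le> c ^ (m - card A) * deg W W"
proof -
  have "\<exists>W F. A \<subseteq> W \<and> card W = m \<and> F \<in> \<G> \<and> W \<subseteq> F \<and>
      card \<G> \<le> c ^ (m - card A) * card {F \<in> \<G>. W \<subseteq> F}"
  proof (rule branch_iter[OF FH int sub])
    show "A \<subseteq> F" if "F \<in> \<G>" for F using that by (rule A)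
    show "\<not> cover \<F> B" if "A \<subseteq> B" "F \<in> \<G>" "B \<subseteq> F" "card B < m" for B F
      using that by (rule non_cover)
  qed fact+
  then obtain W F where W: "A \<subseteq> W" "card W = m" "F \<in> \<G>" "W \<subseteq> F"
      "card \<G> \<le> c ^ (m - card A) * card {F \<in> \<G>. W \<subseteq> F}" by blast
  have "card {F \<in> \<G>. W \<subseteq> F} \<le> deg W W" by (rule card_le_deg_self) (use sub FH in auto)
  then have "c ^ (m - card A) * card {F \<in> \<G>. W \<subseteq> F} \<le> c ^ (m - card A) * deg W W"
    by (rule mult_left_mono) simp
  then have "card \<G> \<le> c ^ (m - card A) * deg W W" using W(5) by linarith
  then show ?thesis using that W(1-4) by blast
qed

section \<open>Cross families and the pairs that generate them\<close>

abbreviation cross :: "'a set \<Rightarrow> 'a set \<Rightarrow> 'a set set" where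
  "cross T Y \<equiv> cross_family p X k T Y"

text \<open>The pairs of the equality case without any condition on their shape; the shape will
  follow from optimality.\<close>

definition good_pair :: "'a set \<Rightarrow> 'a set \<Rightarrow> bool" where
  "good_pair T Y \<longleftrightarrow> feasible_pair p X k T Y \<and> card T = t \<and> 2 \<le> card Y"

lemma good_pairI:
  assumes "T \<subseteq> G" "Y \<subseteq> G" "T \<inter> Y = {}" "\<And>y. y \<in> Y \<Longrightarrow> adm (T \<union> {y})"
    "x \<in> T" "adm (T - {x} \<union> Y)" "card T = t" "2 \<le> card Y"
  shows "good_pair T Y"
  using assms by (auto simp: good_pair_def feasible_pair_def)

lemma cross_sub_H: "cross T Y \<subseteq> H"
  by (auto simp: cross_family_def)

lemma finite_cross: "finite (cross T Y)"
  using cross_sub_H finite_H by (rule finite_subset)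

text \<open>Any \<open>t + 2\<close> points of \<open>W\<close> split into \<open>T\<close> and two
  further points, and all admissibility conditions are inherited from \<open>W\<close>.\<close>

lemma good_pair_of_superset:
  assumes "adm W" "t + 2 \<le> card W" "finite W"
  obtains T y y' where "good_pair T {y, y'}" "insert y T \<subseteq> W" "y \<notin> T" "card (insert y T) = t + 1"
proof -
  obtain Z where Z: "Z \<subseteq> W" "card Z = t + 2" "finite Z" using assms obtain_subset_with_card_n by metis
  obtain T where T: "T \<subseteq> Z" "card T = t" "finite T"
    using obtain_subset_with_card_n[of t Z] Z by auto
  have "card (Z - T) = 2" using T Z by (simp add: card_Diff_subset)
  then obtain y y' where yy: "Z - T = {y, y'}" "y \<noteq> y'" by (auto simp: card_2_iff)
  obtain x where x: "x \<in> T" using T t_pos by (metis card.empty equals0I not_one_le_zero)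
  have "good_pair T {y, y'}"
  proof (rule good_pairI[OF _ _ _ _ x])
    show "T \<subseteq> G" "{y, y'} \<subseteq> G" using assms T Z yy adm_sub by blast+
    show "adm (T \<union> {z})" if "z \<in> {y, y'}" for z
      by (rule adm_subset[OF assms(1)]) (use that yy T Z in blast)
    show "adm (T - {x} \<union> {y, y'})" by (rule adm_subset[OF assms(1)]) (use yy T Z in blast)
    show "T \<inter> {y, y'} = {}" using yy by blast
  qed (use T(2) yy(2) in simp_all)
  moreover have "y \<in> Z" "y \<notin> T" using yy by blast+
  ultimately show ?thesis using that[of T y y'] T Z by auto
qed

lemma deg_le_cross: "y \<in> Y \<Longrightarrow> deg (insert y T) (insert y T) \<le> card (cross T Y)"
  unfolding deg_self by (rule card_mono[OF finite_cross]) (auto simp: cross_family_def)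

text \<open>On the left stands the cost of choosing a \<open>t\<close>-subset of a cover of size
  \<open>m\<close> and branching up to size \<open>m\<close>; on the right the gain in degree from
  size \<open>m\<close> down to \<open>t + 1\<close>. Each step of \<open>m\<close> multiplies the
  left side by at most \<open>(t + 1) * c\<close>.\<close>

lemma binomial_growth:
  assumes "t + 2 \<le> m"
  shows "(m choose t) * c ^ (m - t) < (1 + L) ^ (m - t - 1)"
  using assms
proof (induction m rule: nat_induct_at_least)
  case base
  have "((t + 2) choose t) = ((t + 2) choose 2)" using binomial_symmetric[of t "t + 2"] by simp
  also have "\<dots> = (t + 2) * (t + 1) div 2" by (simp add: choose_two)
  also have "\<dots> \<le> 3 * t\<^sup>2"
  proof -
    have "t \<le> t\<^sup>2" "1 \<le> t\<^sup>2" using t_pos by (auto simp: power2_eq_square)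
    moreover have "(t + 2) * (t + 1) = t\<^sup>2 + 3 * t + 2" by (simp add: power2_eq_square)
    ultimately show ?thesis by linarith
  qed
  finally have "((t + 2) choose t) * c\<^sup>2 \<le> 3 * t\<^sup>2 * c\<^sup>2" by (rule mult_right_mono) simp
  then have "((t + 2) choose t) * c\<^sup>2 < 1 + L" using L_ge1 by linarith
  then show ?case by (simp only: diff_add_inverse) simp
next
  case (Suc m)
  obtain s where s: "t = Suc s" using t_pos by (cases t) auto
  \<comment> \<open>Absorption bounds this summand of Pascal's rule by
    \<open>t * (m choose t)\<close>.\<close>
  have "(m choose s) \<le> (m - s) * (m choose s)" using Suc s by simp
  also have "\<dots> = Suc s * (m choose Suc s)"
    by (simp only: binomial_absorb_comp binomial_absorption)
  finally have "(Suc m choose t) \<le> (t + 1) * (m choose t)" using s by simp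
  then have "(Suc m choose t) * c ^ (Suc m - t) \<le> (t + 1) * (m choose t) * c ^ (Suc m - t)" by simp
  also have "\<dots> = (t + 1) * c * ((m choose t) * c ^ (m - t))"
  proof -
    have "Suc m - t = Suc (m - t)" using Suc.hyps by linarith
    then show ?thesis by (simp only: power_Suc mult_ac)
  qed
  also have "\<dots> \<le> (1 + L) * ((m choose t) * c ^ (m - t))"
  proof (rule mult_right_mono)
    show "(t + 1) * c \<le> 1 + L" using L_ge4 mult_le_mono1[of 1 18 "(t + 1) * c"] by (simp only: mult.assoc mult_1)
  qed simp
  also have "\<dots> < (1 + L) * (1 + L) ^ (m - t - 1)" using Suc.IH by (intro mult_strict_left_mono) simp_all
  also have "\<dots> = (1 + L) ^ (Suc m - t - 1)"
  proof -
    have "Suc m - t - 1 = Suc (m - t - 1)" using Suc.hyps by linarith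
    then show ?thesis by (simp only: power_Suc)
  qed
  finally show ?case .
qed

end

section \<open>At most one small cover\<close>

lemma union_pigeonhole:
  assumes "finite I" "I \<noteq> {}" "\<A> \<subseteq> (\<Union>i\<in>I. B i)" "\<And>i. i \<in> I \<Longrightarrow> finite (B i)"
  obtains i where "i \<in> I" "card \<A> \<le> card I * card (B i)"
proof -
  obtain i where i: "i \<in> I" "\<And>j. j \<in> I \<Longrightarrow> card (B j) \<le> card (B i)"
  proof -
    have "Max ((\<lambda>i. card (B i)) ` I) \<in> (\<lambda>i. card (B i)) ` I" using assms by (intro Max_in) auto
    then obtain i where "i \<in> I" "card (B i) = Max ((\<lambda>i. card (B i)) ` I)" by auto
    then show ?thesis using that assms(1) by simp
  qed
  have "card \<A> \<le> card (\<Union>i\<in>I. B i)" using assms by (intro card_mono) auto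
  also have "\<dots> \<le> (\<Sum>i\<in>I. card (B i))" using assms(1) by (rule card_UN_le)
  also have "\<dots> \<le> card I * card (B i)" using sum_bounded_above[of I "\<lambda>i. card (B i)" "card (B i)"] i(2) by simp
  finally show ?thesis using that i by blast
qed

lemma miss_one:
  assumes "finite S" "card S = Suc m" "m \<le> card (S \<inter> F)" "\<not> S \<subseteq> F"
  obtains x where "x \<in> S" "F \<inter> S = S - {x}"
proof -
  obtain x where x: "x \<in> S" "x \<notin> F" using assms by blast
  have "S \<inter> F \<subseteq> S - {x}" using x by blast
  moreover have "card (S - {x}) \<le> card (S \<inter> F)" using assms x by simp
  ultimately have "S \<inter> F = S - {x}" using assms(1) by (intro card_subset_eq card_seteq) auto
  then show ?thesis using that x by blast
qed

text \<open>An average with weights \<open>L\<close> and 1 of two quantities that are both at most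
  \<open>d\<close> divided by \<open>1 + L\<close>.\<close>

lemma gap:
  fixes L w z d :: nat
  assumes "(1 + L) * w \<le> d" "(1 + L) * z \<le> d"
  shows "L * w + z \<le> d"
proof -
  have "(1 + L) * (L * w + z) = L * ((1 + L) * w) + (1 + L) * z" by (simp add: algebra_simps)
  also have "\<dots> \<le> L * d + d" using assms by (intro add_mono mult_left_mono) auto
  finally have "(1 + L) * (L * w + z) \<le> (1 + L) * d" by simp
  then show ?thesis using mult_le_cancel1[of "1 + L" "L * w + z" d] by linarith
qed

context large_blocks
begin

lemma ex_member: "\<exists>F. F \<in> H"
proof -
  have "0 < deg {} {}" by (rule deg_pos) (auto simp: admissible_set_def)
  then have "{F \<in> H. F \<inter> {} = {}} \<noteq> {}" unfolding deg_def by (metis card.empty less_irrefl)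
  then show ?thesis by blast
qed

text \<open>The empty family is trivial by vacuity as soon as the ground set contains a
  \<open>t\<close>-set, and a member of \<open>H\<close> supplies one.\<close>

lemma nontrivial_nonempty:
  assumes "\<not> t_trivial p X t \<F>"
  shows "\<F> \<noteq> {}"
proof
  assume "\<F> = {}"
  obtain F where F: "F \<in> H" using ex_member by blast
  obtain S where "S \<subseteq> F" "card S = t"
    using obtain_subset_with_card_n[of t F] card_member_K[OF F] K_ge by auto
  then have "t_trivial p X t \<F>" using \<open>\<F> = {}\<close> member_sub[OF F] unfolding t_trivial_def by blast
  then show False using assms by blast
qed

lemma nontrivial_miss:
  assumes "\<not> t_trivial p X t \<F>" "S \<subseteq> G" "t \<le> card S"
  obtains F where "F \<in> \<F>" "\<not> S \<subseteq> F"
proof -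
  obtain S' where "S' \<subseteq> S" "card S' = t" using obtain_subset_with_card_n[OF assms(3)] by metis
  then have "\<not> (\<forall>F\<in>\<F>. S \<subseteq> F)" using assms(1,2) unfolding t_trivial_def by blast
  then show ?thesis using that by blast
qed

text \<open>A cover with at most \<open>t\<close> points would have exactly \<open>t\<close> points
  and lie in every member.\<close>

lemma nontrivial_not_cover:
  assumes "\<not> t_trivial p X t \<F>" "S \<subseteq> G" "card S \<le> t"
  shows "\<not> cover \<F> S"
proof
  assume c: "cover \<F> S"
  have fS: "finite S" using assms(2) by (rule finite_sub_ground)
  have eq: "t \<le> card S \<and> S \<subseteq> F" if "F \<in> \<F>" for F
  proof -
    have "t \<le> card (S \<inter> F)" using c that by (rule coverD)
    moreover have "card (S \<inter> F) \<le> card S" using fS by (intro card_mono) auto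
    ultimately have "t \<le> card S" "card S \<le> card (S \<inter> F)" using assms(3) by linarith+
    then show ?thesis using card_seteq[OF fS, of "S \<inter> F"] by blast
  qed
  obtain E where "E \<in> \<F>" using nontrivial_nonempty[OF assms(1)] by blast
  then have "t \<le> card S" using eq by blast
  then obtain F where "F \<in> \<F>" "\<not> S \<subseteq> F" using nontrivial_miss[OF assms(1,2)] by blast
  then show False using eq by blast
qed

text \<open>A union bound over the \<open>t\<close>-subsets of a smallest cover of size at least
  \<open>t + 2\<close> is followed by branching up to that size. By \<open>binomial_growth\<close>
  the members through some \<open>t + 1\<close> points already outnumber the result.\<close>

lemma no_small_cover_case:
  assumes FH: "\<F> \<subseteq> H" and int: "t_intersecting t \<F>" and nt: "\<not> t_trivial p X t \<F>"
    and none: "\<And>S. adm S \<Longrightarrow> card S = t + 1 \<Longrightarrow> \<not> cover \<F> S"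
  shows "\<exists>T Y. good_pair T Y \<and> card \<F> < card (cross T Y)"
proof -
  have finF: "finite \<F>" using FH finite_H by (rule finite_subset)
  \<comment> \<open>Minimality ranges over all finite covers of size at least \<open>t + 2\<close>;
    a member is one, so the minimum exists.\<close>
  define Q where "Q m \<longleftrightarrow> t + 2 \<le> m \<and> (\<exists>S. finite S \<and> card S = m \<and> cover \<F> S)" for m
  obtain F0 where F0: "F0 \<in> \<F>" using nontrivial_nonempty[OF nt] by blast
  then have "F0 \<in> H" using FH by blast
  then have QK: "Q K" unfolding Q_def
    using card_member_K finite_member member_cover[OF int F0] K_ge by blast
  define m where "m = (LEAST m. Q m)"
  have "Q m" unfolding m_def using QK by (rule LeastI)
  then obtain S where S: "t + 2 \<le> m" "finite S" "card S = m" "cover \<F> S" unfolding Q_def by blast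
  let ?I = "{A. A \<subseteq> S \<and> card A = t}" and ?B = "\<lambda>A. {F \<in> \<F>. A \<subseteq> F}"
  have cardI: "card ?I = m choose t" using n_subsets[OF S(2)] S(3) by simp
  have UN: "\<F> \<subseteq> (\<Union>A\<in>?I. ?B A)"
  proof
    fix F assume F: "F \<in> \<F>"
    obtain A where "A \<subseteq> S \<inter> F" "card A = t"
      using obtain_subset_with_card_n[OF coverD[OF S(4) F]] by metis
    then show "F \<in> (\<Union>A\<in>?I. ?B A)" using F by blast
  qed
  have neI: "?I \<noteq> {}" using UN F0 by blast
  have finI: "finite ?I" using S(2) by simp
  have finB: "finite (?B A)" for A using finF by simp
  obtain A where "A \<in> ?I" "card \<F> \<le> card ?I * card (?B A)"
    by (rule union_pigeonhole[OF finI neI UN finB])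
  then have A: "A \<subseteq> S" "card A = t" "card \<F> \<le> (m choose t) * card (?B A)"
    unfolding cardI by simp_all
  have posF: "0 < card \<F>" using F0 finF by (auto simp: card_gt_0_iff)
  then have posB: "0 < card (?B A)" using A(3) by (cases "card (?B A)") auto
  then have neB: "?B A \<noteq> {}" by (metis card.empty less_irrefl)
  have nc: "\<not> cover \<F> B" if B: "A \<subseteq> B" "F \<in> ?B A" "B \<subseteq> F" "card B < m" for B F
  proof -
    have FH': "F \<in> H" using B(2) FH by blast
    have finB: "finite B" using B(3) finite_member[OF FH'] by (rule finite_subset)
    have BG: "B \<subseteq> G" using B(3) member_sub[OF FH'] by blast
    have "t \<le> card B" using card_mono[OF finB B(1)] A(2) by simp
    \<comment> \<open>Sizes \<open>t\<close> and \<open>t + 1\<close> are excluded by nontriviality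
      and by \<open>none\<close>, larger ones by minimality of \<open>m\<close>.\<close>
    then consider "card B = t" | "card B = t + 1" | "t + 2 \<le> card B" by linarith
    then show ?thesis
    proof cases
      case 1 then show ?thesis using nontrivial_not_cover[OF nt BG] by simp
    next
      case 2 then show ?thesis using none[OF adm_subset_member[OF FH' B(3)]] by simp
    next
      case 3
      have "\<not> Q (card B)" using B(4) unfolding m_def by (rule not_less_Least)
      then show ?thesis using 3 finB unfolding Q_def by blast
    qed
  qed
  obtain W E where W: "A \<subseteq> W" "card W = m" "E \<in> ?B A" "W \<subseteq> E" "card (?B A) \<le> c ^ (m - card A) * deg W W"
  proof (rule branch_iter_deg[OF FH int _ _ neB])
    show "?B A \<subseteq> \<F>" by blast
    show "card A \<le> m" using A(2) S(1) by simp
    show "\<not> cover \<F> B" if "A \<subseteq> B" "F \<in> ?B A" "B \<subseteq> F" "card B < m" for B F using nc[OF that] .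
  qed blast+
  have EH: "E \<in> H" using W(3) FH by blast
  have admW: "adm W" using adm_subset_member[OF EH W(4)] .
  have finW: "finite W" using finite_subset[OF W(4) finite_member[OF EH]] .
  obtain T y y' where T: "good_pair T {y, y'}" "insert y T \<subseteq> W" "y \<notin> T" "card (insert y T) = t + 1"
    using good_pair_of_superset[OF admW _ finW] W(2) S(1) by metis
  have posW: "0 < deg W W" using posB W(5) by (cases "deg W W") auto
  have "card (W - insert y T) = m - t - 1"
    using card_Diff_subset[OF finite_subset[OF T(2) finW] T(2)] W(2) T(4) by simp
  then have chain: "(1 + L) ^ (m - t - 1) * deg W W \<le> deg (insert y T) (insert y T)"
    using deg_self_chain[OF adm_sub[OF admW] T(2)] by simp
  have "card \<F> \<le> (m choose t) * (c ^ (m - t) * deg W W)"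
    using A(3) W(5) A(2) by (metis le_trans mult_le_mono2)
  also have "\<dots> = ((m choose t) * c ^ (m - t)) * deg W W" by simp
  also have "\<dots> < (1 + L) ^ (m - t - 1) * deg W W"
    using binomial_growth[OF S(1)] posW by (rule mult_strict_right_mono)
  also note chain
  also have "deg (insert y T) (insert y T) \<le> card (cross T {y, y'})" by (rule deg_le_cross) simp
  finally show ?thesis using T(1) by blast
qed

text \<open>A member not containing \<open>S\<close> misses exactly one point \<open>x\<close>;
  branching from \<open>S - {x}\<close> bounds such members by the degree of a set of size
  \<open>t + 2\<close>. The cross family of \<open>S - {x}\<close> and \<open>{x, z}\<close> keeps
  all members through \<open>S\<close> and gains many through \<open>z\<close>.\<close>

lemma unique_cover_case:
  assumes FH: "\<F> \<subseteq> H" and int: "t_intersecting t \<F>" and nt: "\<not> t_trivial p X t \<F>"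
    and S: "adm S" "card S = t + 1" "cover \<F> S"
    and unique: "\<And>S'. adm S' \<Longrightarrow> card S' = t + 1 \<Longrightarrow> cover \<F> S' \<Longrightarrow> S' = S"
  shows "\<exists>T Y. good_pair T Y \<and> card \<F> < card (cross T Y)"
proof -
  have finF: "finite \<F>" using FH finite_H by (rule finite_subset)
  have SG: "S \<subseteq> G" and finS: "finite S" using adm_sub[OF S(1)] finite_sub_ground by auto
  let ?B = "\<lambda>x. {F \<in> \<F>. F \<inter> S = S - {x}}" and ?N = "{F \<in> \<F>. \<not> S \<subseteq> F}"
  have UN: "?N \<subseteq> (\<Union>x\<in>S. ?B x)"
  proof
    fix F assume "F \<in> ?N"
    then have F: "F \<in> \<F>" "\<not> S \<subseteq> F" by auto
    obtain x where "x \<in> S" "F \<inter> S = S - {x}"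
      by (rule miss_one[OF finS, of t F]) (use S(2) coverD[OF S(3) F(1)] F in auto)
    then show "F \<in> (\<Union>x\<in>S. ?B x)" using F by blast
  qed
  have neS: "S \<noteq> {}" using S(2) by auto
  obtain x where x: "x \<in> S" "card ?N \<le> (t + 1) * card (?B x)"
    using union_pigeonhole[OF finS neS UN] finF S(2) by auto
  obtain F0 where "F0 \<in> \<F>" "\<not> S \<subseteq> F0" using nontrivial_miss[OF nt SG] S(2) by auto
  then have "0 < card ?N" using finF by (auto simp: card_gt_0_iff)
  then have posB: "0 < card (?B x)" using x(2) by (cases "card (?B x)") auto
  then have neB: "?B x \<noteq> {}" by (metis card.empty less_irrefl)
  have cSx: "card (S - {x}) = t" using S(2) x(1) finS by simp
  have nc: "\<not> cover \<F> B" if B: "S - {x} \<subseteq> B" "F \<in> ?B x" "B \<subseteq> F" "card B < t + 2" for B F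
  proof -
    have FH': "F \<in> H" using B(2) FH by blast
    have BG: "B \<subseteq> G" using B(3) member_sub[OF FH'] by blast
    \<comment> \<open>\<open>B\<close> avoids \<open>x\<close>, so it differs from the only small
      cover.\<close>
    have "x \<notin> F" using B(2) x(1) by blast
    then have "B \<noteq> S" using B(3) x(1) by blast
    moreover have "card B \<le> t \<or> card B = t + 1" using B(4) by linarith
    ultimately show ?thesis
      using nontrivial_not_cover[OF nt BG] unique[OF adm_subset_member[OF FH' B(3)]] by blast
  qed
  obtain W E where W: "S - {x} \<subseteq> W" "card W = t + 2" "E \<in> ?B x" "W \<subseteq> E"
      "card (?B x) \<le> c ^ (t + 2 - card (S - {x})) * deg W W"
  proof (rule branch_iter_deg[OF FH int _ _ neB])
    show "?B x \<subseteq> \<F>" by blast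
    show "card (S - {x}) \<le> t + 2" using cSx by simp
    show "\<not> cover \<F> B" if "S - {x} \<subseteq> B" "F \<in> ?B x" "B \<subseteq> F" "card B < t + 2" for B F using nc[OF that] .
  qed blast+
  have EH: "E \<in> H" using W(3) FH by blast
  have admW: "adm W" using adm_subset_member[OF EH W(4)] .
  have WG: "W \<subseteq> G" by (rule adm_sub[OF admW])
  have finW: "finite W" by (rule finite_sub_ground[OF WG])
  have xW: "x \<notin> W" using W(3,4) x(1) by blast
  have bx: "card (?B x) \<le> c\<^sup>2 * deg W W" using W(5) unfolding cSx by (simp only: diff_add_inverse)
  have posW: "0 < deg W W" using posB bx by (cases "deg W W") auto
  \<comment> \<open>\<open>W\<close> is larger than \<open>S\<close>, hence has room for one more element in some block.\<close>
  obtain i where i: "i \<in> {1..p}" "card (S \<inter> X i) < card (W \<inter> X i)"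
  proof -
    have "\<not> (\<forall>i\<in>{1..p}. card (W \<inter> X i) \<le> card (S \<inter> X i))"
    proof
      assume "\<forall>i\<in>{1..p}. card (W \<inter> X i) \<le> card (S \<inter> X i)"
      then have "card W \<le> card S" unfolding card_split_blocks[OF SG] card_split_blocks[OF WG]
        by (intro sum_mono) blast
      then show False using S(2) W(2) by simp
    qed
    then show ?thesis using that by (auto simp: not_le)
  qed
  have "\<not> W \<inter> X i \<subseteq> S \<inter> X i" using i(2) card_mono[of "S \<inter> X i" "W \<inter> X i"] finS by auto
  then obtain z where z: "z \<in> W" "z \<in> X i" "z \<notin> S" by blast
  have admZ: "adm (insert z S)"
  proof -
    have "card (insert z S \<inter> X j) \<le> k j" if j: "j \<in> {1..p}" for j
    proof -
      have "card (S \<inter> X j) \<le> k j" "card (W \<inter> X j) \<le> k j"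
        using S(1) admW j by (auto simp: admissible_set_def)
      then show ?thesis using card_insert_block[OF i(1) z(2,3) SG j] i(2) by (cases "j = i") auto
    qed
    then show ?thesis using SG z(1) WG by (auto simp: admissible_set_def)
  qed
  let ?T = "S - {x}"
  have zx: "z \<noteq> x" using z(3) x(1) by blast
  have good: "good_pair ?T {x, z}"
  proof -
    have "?T \<noteq> {}" using cSx t_pos by (metis card.empty not_one_le_zero)
    then obtain x' where x': "x' \<in> ?T" by blast
    show ?thesis
    proof (rule good_pairI[OF _ _ _ _ x'])
      show "?T \<subseteq> G" "{x, z} \<subseteq> G" using SG x(1) z(1) WG by auto
      show "?T \<inter> {x, z} = {}" using z(3) by blast
      show "adm (?T \<union> {v})" if "v \<in> {x, z}" for v
        by (rule adm_subset[OF admZ]) (use that x(1) in blast)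
      show "adm (?T - {x'} \<union> {x, z})" by (rule adm_subset[OF admZ]) (use x(1) in blast)
    qed (use cSx zx in auto)
  qed
  \<comment> \<open>Inclusion-exclusion for the members through \<open>S\<close> and those through
    \<open>insert z ?T\<close>; the overlap is the degree of \<open>insert z S\<close>.\<close>
  let ?A = "{F \<in> H. S \<subseteq> F}" and ?A' = "{F \<in> H. insert z ?T \<subseteq> F}"
  have "card (?A \<union> ?A') \<le> card (cross ?T {x, z})"
    by (rule card_mono[OF finite_cross]) (use x(1) in \<open>auto simp: cross_family_def\<close>)
  moreover have "card ?A + card ?A' = card (?A \<union> ?A') + card (?A \<inter> ?A')"
    using finite_H by (intro card_Un_Int) auto
  moreover have "card (?A \<inter> ?A') = deg (insert z S) (insert z S)"
    unfolding deg_self by (rule arg_cong[where f = card]) (use x(1) in auto)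
  ultimately have low: "deg S S + deg (insert z ?T) (insert z ?T)
      \<le> card (cross ?T {x, z}) + deg (insert z S) (insert z S)"
    by (simp only: deg_self)
  have "card \<F> \<le> card {F \<in> \<F>. S \<subseteq> F} + card ?N"
  proof -
    have "\<F> = {F \<in> \<F>. S \<subseteq> F} \<union> ?N" by blast
    then show ?thesis using card_Un_le[of "{F \<in> \<F>. S \<subseteq> F}" ?N] by simp
  qed
  also have "card {F \<in> \<F>. S \<subseteq> F} \<le> deg S S" by (rule card_le_deg_self) (use FH in auto)
  also have "card ?N \<le> (t + 1) * (c\<^sup>2 * deg W W)" using x(2) bx by (meson le_trans mult_le_mono2)
  finally have up: "card \<F> \<le> deg S S + (t + 1) * c\<^sup>2 * deg W W" by (simp only: mult.assoc)
  have "insert z ?T \<subset> W"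
  proof -
    have "insert z ?T \<subseteq> W" using z(1) W(1) by blast
    moreover have "card (insert z ?T) = t + 1" using z(3) cSx finS by simp
    ultimately show ?thesis using W(2) by auto
  qed
  then have g1: "(1 + L) * deg W W \<le> deg (insert z ?T) (insert z ?T)" by (rule deg_self_ratio[OF WG])
  have "insert z ?T \<subset> insert z S" using x(1) zx by auto
  then have g2: "(1 + L) * deg (insert z S) (insert z S) \<le> deg (insert z ?T) (insert z ?T)"
    using adm_sub[OF admZ] by (rule deg_self_ratio[rotated])
  \<comment> \<open>With this, \<open>gap\<close> lets the surplus pay for both the error term and
    the overlap.\<close>
  have "(t + 1) * c\<^sup>2 < L"
  proof -
    have "0 < (t + 1) * c\<^sup>2" using c_ge by simp
    then show ?thesis using L_ge3 by linarith
  qed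
  then have "(t + 1) * c\<^sup>2 * deg W W < L * deg W W" using posW by (rule mult_strict_right_mono)
  then have "card \<F> < card (cross ?T {x, z})" using gap[OF g1 g2] low up by linarith
  then show ?thesis using good by blast
qed

end

section \<open>Several small covers\<close>

lemma insert_Int_eq:
  assumes "finite S" "card S = Suc (card (S \<inter> S'))"
  shows "\<exists>y. y \<in> S \<and> y \<notin> S' \<and> insert y (S \<inter> S') = S"
proof -
  have "card (S - S') = 1" using assms by (simp add: card_Diff_subset_Int)
  then obtain y where "S - S' = {y}" by (rule card_1_singletonE)
  then show ?thesis by blast
qed

text \<open>If \<open>f\<close> reached both \<open>m\<close> and \<open>m'\<close>, then
  \<open>a + b\<close> would be at least \<open>d\<close> and at least \<open>e\<close>, so
  \<open>2 * (a + b) \<ge> d + e \<ge> 3 * (a + b)\<close>, contradicting \<open>0 < d\<close>. Two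
  comparisons are made because each error is small only against its own gain.\<close>

lemma exceeds_one:
  fixes f p a b d e m m' :: nat
  assumes "f \<le> p + a + b" "3 * a \<le> e" "3 * b \<le> d" "p + e \<le> m'" "p + d \<le> m" "0 < d"
  shows "f < m \<or> f < m'"
  using assms by linarith

context large_blocks
begin

text \<open>A member may miss only one of the \<open>t + 1\<close> points of the cover; if that
  point lies in \<open>T\<close>, then \<open>y\<close> is not missed.\<close>

lemma cover_insert_miss:
  assumes "cover \<F> (insert y T)" "F \<in> \<F>" "y \<notin> T" "finite T" "card T = t" "\<not> T \<subseteq> F"
  shows "\<exists>x\<in>T. F \<inter> T = T - {x} \<and> y \<in> F"
proof -
  have "t \<le> card (insert y T \<inter> F)" using assms(1,2) by (rule coverD)
  moreover have "card (insert y T) = Suc t" using assms(3-5) by simp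
  ultimately obtain x where x: "x \<in> insert y T" "F \<inter> insert y T = insert y T - {x}"
    using miss_one[of "insert y T" t F] assms(4,6) by blast
  have "x \<noteq> y" using x(2) assms(3,6) by blast
  then show ?thesis using x assms(3) by blast
qed

text \<open>Extend \<open>S\<close> to a member \<open>E\<close> without further points of
  \<open>S'\<close>, then \<open>S'\<close> to a member \<open>E'\<close> without further points of
  \<open>E\<close>. Both are covers, \<open>E'\<close> lies in \<open>\<F>\<close> by maximality,
  and \<open>E \<inter> E' = S \<inter> S'\<close>.\<close>

lemma maximal_covers_intersect:
  assumes max: "\<And>E. E \<in> H \<Longrightarrow> cover \<F> E \<Longrightarrow> E \<in> \<F>"
    and S: "adm S" "cover \<F> S" and S': "adm S'" "cover \<F> S'"
  shows "t \<le> card (S \<inter> S')"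
proof -
  have fin: "finite S" "finite S'" using S S' adm_sub finite_sub_ground by auto
  have "0 < deg (S \<union> S') S"
  proof (rule deg_pos)
    show "card (S \<union> S') \<le> 2 * K"
      using card_Un_le[of S S'] adm_card_K[OF S(1)] adm_card_K[OF S'(1)] by linarith
  qed (use S S' adm_sub in auto)
  then have "{F \<in> H. F \<inter> (S \<union> S') = S} \<noteq> {}" unfolding deg_def by (metis card.empty less_irrefl)
  then obtain E where E: "E \<in> H" "E \<inter> (S \<union> S') = S" by blast
  have "0 < deg (S' \<union> E) S'"
  proof (rule deg_pos)
    show "card (S' \<union> E) \<le> 2 * K"
      using card_Un_le[of S' E] card_member_K[OF E(1)] adm_card_K[OF S'(1)] by linarith
  qed (use S' adm_sub member_sub[OF E(1)] in auto)
  then have "{F \<in> H. F \<inter> (S' \<union> E) = S'} \<noteq> {}" unfolding deg_def by (metis card.empty less_irrefl)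
  then obtain E' where E': "E' \<in> H" "E' \<inter> (S' \<union> E) = S'" by blast
  have "cover \<F> E" by (rule cover_mono[OF S(2)]) (use E finite_member[OF E(1)] in auto)
  moreover have "cover \<F> E'" by (rule cover_mono[OF S'(2)]) (use E' finite_member[OF E'(1)] in auto)
  then have "E' \<in> \<F>" using max E'(1) by blast
  ultimately have "t \<le> card (E \<inter> E')" by (rule coverD)
  moreover have "E \<inter> E' = S \<inter> S'" using E(2) E'(2) by blast
  ultimately show ?thesis by simp
qed

text \<open>Since \<open>S\<close> misses a point \<open>x\<close> of \<open>T\<close>, it must
  equal \<open>T - {x} \<union> {y1, y2}\<close>. As a cover it prevents a member through
  \<open>T\<close> from avoiding both points, and a member missing a point of \<open>T\<close>
  contains both.\<close>

lemma crossing_covers_case: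
  assumes T: "card T = t" "T \<subseteq> G" and y: "y1 \<notin> T" "y2 \<notin> T" "y1 \<noteq> y2"
    and c1: "adm (insert y1 T)" "cover \<F> (insert y1 T)"
    and c2: "adm (insert y2 T)" "cover \<F> (insert y2 T)"
    and c3: "adm S" "card S = t + 1" "cover \<F> S" "\<not> T \<subseteq> S"
    and i1: "t \<le> card (insert y1 T \<inter> S)" and i2: "t \<le> card (insert y2 T \<inter> S)"
    and FH: "\<F> \<subseteq> H"
  shows "good_pair T {y1, y2} \<and> \<F> \<subseteq> cross T {y1, y2}"
proof -
  have finT: "finite T" using finite_sub_ground[OF T(2)] .
  have finS: "finite S" using finite_sub_ground[OF adm_sub[OF c3(1)]] .
  \<comment> \<open>Treating \<open>S\<close> as a family with one member lets
    \<open>cover_insert_miss\<close> describe its trace.\<close>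
  have "cover {S} (insert y1 T)" "cover {S} (insert y2 T)" using i1 i2 by (auto simp: cover_def)
  then obtain x where x: "x \<in> T" "S \<inter> T = T - {x}" "y1 \<in> S" "y2 \<in> S"
    using cover_insert_miss[of "{S}" y1 T S] cover_insert_miss[of "{S}" y2 T S] y finT T(1) c3(4) by blast
  have card1: "card (T - {x} \<union> {y1, y2}) = t + 1"
  proof -
    have "card (T - {x} \<union> {y1, y2}) = card (T - {x}) + card {y1, y2}"
      by (rule card_Un_disjoint) (use finT y in auto)
    then show ?thesis using x(1) T(1) finT y(3) t_pos by simp
  qed
  have sub: "T - {x} \<union> {y1, y2} \<subseteq> S" using x by blast
  have S: "S = T - {x} \<union> {y1, y2}"
    using card_seteq[OF finS sub] card1 c3(2) by simp
  have good: "good_pair T {y1, y2}"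
  proof (rule good_pairI[OF T(2) _ _ _ x(1)])
    show "{y1, y2} \<subseteq> G" using adm_sub[OF c1(1)] adm_sub[OF c2(1)] by blast
    show "adm (T \<union> {v})" if "v \<in> {y1, y2}" for v
      using that c1(1) c2(1) by (cases "v = y1") auto
    show "adm (T - {x} \<union> {y1, y2})" using c3(1) S by simp
  qed (use T y in auto)
  have "F \<in> cross T {y1, y2}" if F: "F \<in> \<F>" for F
  proof (cases "T \<subseteq> F")
    case True
    have "F \<inter> {y1, y2} \<noteq> {}"
    proof
      assume "F \<inter> {y1, y2} = {}"
      then have "S \<inter> F \<subseteq> T - {x}" using S by blast
      then have "card (S \<inter> F) \<le> card (T - {x})" using finT by (intro card_mono) auto
      moreover have "card (T - {x}) < t" using x(1) T(1) finT t_pos by simp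
      ultimately show False using coverD[OF c3(3) F] by linarith
    qed
    then show ?thesis using True F FH by (auto simp: cross_family_def)
  next
    case False
    obtain v where v: "v \<in> T" "F \<inter> T = T - {v}" "y1 \<in> F"
      using cover_insert_miss[OF c1(2) F y(1) finT T(1) False] by blast
    have "y2 \<in> F" using cover_insert_miss[OF c2(2) F y(2) finT T(1) False] by blast
    then show ?thesis using v F FH by (auto simp: cross_family_def)
  qed
  then show ?thesis using good by blast
qed

text \<open>Each of the at most \<open>c\<close> points of \<open>Y\<close> accounts for at most the
  fraction \<open>1 / (1 + L)\<close> of the members through \<open>S\<close>; denominators are
  cleared.\<close>

lemma deg_avoid_lower:
  assumes "S \<subseteq> G" "Y \<subseteq> G" "S \<inter> Y = {}" "card Y \<le> c"
  shows "(1 + L - c) * deg S S \<le> (1 + L) * card {F \<in> H. S \<subseteq> F \<and> F \<inter> Y = {}}"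
proof -
  let ?E = "{F \<in> H. S \<subseteq> F \<and> F \<inter> Y = {}}"
  have finY: "finite Y" using finite_sub_ground[OF assms(2)] .
  have "{F \<in> H. S \<subseteq> F} \<subseteq> ?E \<union> (\<Union>y\<in>Y. {F \<in> H. insert y S \<subseteq> F})" by blast
  then have "deg S S \<le> card (?E \<union> (\<Union>y\<in>Y. {F \<in> H. insert y S \<subseteq> F}))"
    unfolding deg_self using finY finite_H by (intro card_mono) auto
  also have "\<dots> \<le> card ?E + card (\<Union>y\<in>Y. {F \<in> H. insert y S \<subseteq> F})" by (rule card_Un_le)
  also have "card (\<Union>y\<in>Y. {F \<in> H. insert y S \<subseteq> F}) \<le> (\<Sum>y\<in>Y. deg (insert y S) (insert y S))"
    unfolding deg_self using finY by (rule card_UN_le)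
  finally have "deg S S \<le> card ?E + (\<Sum>y\<in>Y. deg (insert y S) (insert y S))" by simp
  then have "(1 + L) * deg S S \<le> (1 + L) * (card ?E + (\<Sum>y\<in>Y. deg (insert y S) (insert y S)))"
    by (rule mult_le_mono2)
  moreover have "(\<Sum>y\<in>Y. (1 + L) * deg (insert y S) (insert y S)) \<le> (\<Sum>y\<in>Y. deg S S)"
  proof (rule sum_mono)
    fix y assume "y \<in> Y"
    then show "(1 + L) * deg (insert y S) (insert y S) \<le> deg S S"
      using deg_ratio_self[of y S] assms(1-3) by blast
  qed
  moreover have "(\<Sum>y\<in>Y. deg S S) \<le> c * deg S S" using assms(4) by simp
  ultimately have "(1 + L) * deg S S \<le> (1 + L) * card ?E + c * deg S S"
    unfolding add_mult_distrib2 sum_distrib_left by linarith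
  then show ?thesis unfolding diff_mult_distrib by linarith
qed

text \<open>Members through \<open>T\<close> avoiding \<open>Y\<close> and members missing a point
  of \<open>T\<close> obstruct each other: a member of either kind is a set over which the other
  kind branches, so both kinds are small when both exist.\<close>

lemma common_kernel_case:
  assumes FH: "\<F> \<subseteq> H" and int: "t_intersecting t \<F>" and nt: "\<not> t_trivial p X t \<F>"
    and T: "card T = t" "T \<subseteq> G"
    and kernel: "\<And>S. adm S \<Longrightarrow> card S = t + 1 \<Longrightarrow> cover \<F> S \<Longrightarrow> T \<subseteq> S"
    and y: "y1 \<notin> T" "y2 \<notin> T" "y1 \<noteq> y2"
    and c1: "adm (insert y1 T)" "cover \<F> (insert y1 T)"
    and c2: "adm (insert y2 T)" "cover \<F> (insert y2 T)"
  shows "\<exists>T Y. good_pair T Y \<and> (card \<F> < card (cross T Y) \<or> \<F> \<subseteq> cross T Y)"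
proof -
  have finF: "finite \<F>" using FH finite_H by (rule finite_subset)
  have finT: "finite T" using finite_sub_ground[OF T(2)] .
  have cT: "card (T - {x}) < t" if "x \<in> T" for x using that T(1) finT t_pos by simp
  define Y where "Y = {y \<in> G. y \<notin> T \<and> adm (insert y T) \<and> cover \<F> (insert y T)}"
  have YG: "Y \<subseteq> G" and YT: "T \<inter> Y = {}" by (auto simp: Y_def)
  have finY: "finite Y" using finite_sub_ground[OF YG] .
  have yY: "y1 \<in> Y" "y2 \<in> Y" using y c1 c2 adm_sub by (auto simp: Y_def)
  have "{y1, y2} \<subseteq> Y" using yY by blast
  then have "card {y1, y2} \<le> card Y" using finY by (intro card_mono)
  then have cardY: "2 \<le> card Y" using y(3) by simp
  have miss: "\<exists>x\<in>T. F \<inter> T = T - {x} \<and> Y \<subseteq> F" if F: "F \<in> \<F>" "\<not> T \<subseteq> F" for F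
  proof -
    obtain x where x: "x \<in> T" "F \<inter> T = T - {x}"
      using cover_insert_miss[OF c1(2) F(1) y(1) finT T(1) F(2)] by blast
    have "v \<in> F" if "v \<in> Y" for v
      using cover_insert_miss[of \<F> v T F] that F finT T(1) unfolding Y_def by blast
    then show ?thesis using x by blast
  qed
  obtain B0 where B0: "B0 \<in> \<F>" "\<not> T \<subseteq> B0" using nontrivial_miss[OF nt T(2)] T(1) by auto
  obtain x0 where x0: "x0 \<in> T" "B0 \<inter> T = T - {x0}" "Y \<subseteq> B0" using miss[OF B0] by blast
  have B0H: "B0 \<in> H" using B0 FH by blast
  have admT: "adm (T \<union> {v})" if "v \<in> Y" for v using that unfolding Y_def by simp
  have good: "good_pair T Y"
  proof (rule good_pairI[OF T(2) YG YT admT x0(1) _ T(1) cardY])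
    show "adm (T - {x0} \<union> Y)" by (rule adm_subset_member[OF B0H]) (use x0 in blast)
  qed
  have finB0: "finite B0" using finite_member[OF B0H] .
  \<comment> \<open>\<open>Y\<close> fits into the part of \<open>B0\<close> outside
    \<open>T\<close>, which has \<open>K - (t - 1)\<close> points.\<close>
  have cardYc: "card Y \<le> c"
  proof -
    have "card Y \<le> card (B0 - T)" using x0(3) YT finB0 by (intro card_mono) auto
    also have "card (B0 - T) = card B0 - card (B0 \<inter> T)" using finB0 by (simp add: card_Diff_subset_Int)
    also have "\<dots> = K - (t - 1)" using card_member_K[OF B0H] x0(1,2) T(1) finT by simp
    finally show ?thesis using t_pos K_ge by (simp add: c_def)
  qed
  define A where "A = {F \<in> \<F>. T \<subseteq> F \<and> F \<inter> Y = {}}"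
  show ?thesis
  proof (cases "A = {}")
    case True
    have "F \<in> cross T Y" if F: "F \<in> \<F>" for F
    proof (cases "T \<subseteq> F")
      case True
      then have "F \<inter> Y \<noteq> {}" using \<open>A = {}\<close> F unfolding A_def by blast
      then show ?thesis using True F FH by (auto simp: cross_family_def)
    next
      case False
      then show ?thesis using miss[OF F False] F FH by (auto simp: cross_family_def)
    qed
    then show ?thesis using good by blast
  next
    case False
    have finA: "finite A" using finF by (simp add: A_def)
    \<comment> \<open>Branching over \<open>B0\<close> yields a point \<open>y'\<close> outside
      \<open>Y\<close>. So no set of size \<open>t + 1\<close> through \<open>insert y' T\<close>
      inside a member is a cover, which allows a second branching.\<close>
    have "card (T \<inter> B0) < t" using cT[OF x0(1)] x0(2) by (simp add: Int_commute)
    moreover have "A \<subseteq> \<F>" "\<And>F. F \<in> A \<Longrightarrow> T \<subseteq> F" by (auto simp: A_def)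
    ultimately obtain y' where y': "y' \<in> B0" "y' \<notin> T" "card A \<le> c * card {F \<in> A. y' \<in> F}"
      using branch[OF FH int, of A T B0] B0(1) by blast
    let ?A = "{F \<in> A. y' \<in> F}"
    have "card A \<noteq> 0" using False finA by simp
    then have posA: "card ?A \<noteq> 0" using y'(3) by (cases "card ?A") auto
    then have neA: "?A \<noteq> {}" by (metis card.empty)
    then have y'Y: "y' \<notin> Y" by (auto simp: A_def)
    have cTy: "card (insert y' T) = t + 1" using y'(2) finT T(1) by simp
    obtain W E where W: "insert y' T \<subseteq> W" "card W = t + 2" "E \<in> ?A" "W \<subseteq> E"
      "card ?A \<le> c ^ (t + 2 - card (insert y' T)) * deg W W"
    proof (rule branch_iter_deg[OF FH int _ _ neA])
      show "?A \<subseteq> \<F>" by (auto simp: A_def)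
      show "insert y' T \<subseteq> F" if "F \<in> ?A" for F using that by (auto simp: A_def)
      show "card (insert y' T) \<le> t + 2" using cTy by simp
      show "\<not> cover \<F> B" if B: "insert y' T \<subseteq> B" "F \<in> ?A" "B \<subseteq> F" "card B < t + 2" for B F
      proof
        assume cov: "cover \<F> B"
        have FH': "F \<in> H" using B(2) FH by (auto simp: A_def)
        have "finite B" using finite_subset[OF B(3) finite_member[OF FH']] .
        then have "insert y' T = B" using B(1,4) cTy by (intro card_seteq) auto
        then have "adm (insert y' T)" "cover \<F> (insert y' T)" "y' \<in> G"
          using adm_subset_member[OF FH' B(3)] cov member_sub[OF FH'] B(3) by auto
        then show False using y'(2) y'Y unfolding Y_def by blast
      qed
    qed blast+
    have EH: "E \<in> H" using W(3) FH by (auto simp: A_def)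
    have admW: "adm W" using adm_subset_member[OF EH W(4)] .
    have WG: "W \<subseteq> G" using adm_sub[OF admW] .
    have cardA: "card A \<le> c * (c * deg W W)"
    proof -
      have "t + 2 - card (insert y' T) = 1" using cTy by simp
      then have "card ?A \<le> c * deg W W" using W(5) by simp
      then have "c * card ?A \<le> c * (c * deg W W)" by simp
      then show ?thesis using y'(3) by linarith
    qed
    have ratW: "(1 + L) * deg W W \<le> deg (insert y' T) (insert y' T)"
      by (rule deg_self_ratio[OF WG]) (use W(1,2) cTy in auto)
    let ?N = "{F \<in> \<F>. \<not> T \<subseteq> F}" and ?B = "\<lambda>x. {F \<in> \<F>. F \<inter> T = T - {x} \<and> Y \<subseteq> F}"
    have UN: "?N \<subseteq> (\<Union>x\<in>T. ?B x)" using miss by blast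
    have finB: "finite (?B x)" for x using finF by simp
    have neT: "T \<noteq> {}" using x0(1) by blast
    obtain x where x: "x \<in> T" "card ?N \<le> card T * card (?B x)"
      by (rule union_pigeonhole[OF finT neT UN finB])
    have "0 < card ?N" using B0 finF by (auto simp: card_gt_0_iff)
    then have posB: "0 < card (?B x)" using x(2) by (cases "card (?B x)") auto
    obtain A0 where A0: "A0 \<in> \<F>" "T \<subseteq> A0" "A0 \<inter> Y = {}" using False by (auto simp: A_def)
    \<comment> \<open>Likewise \<open>A0\<close> meets \<open>?V\<close> only in
      \<open>T - {x}\<close>, and branching over it adds a point \<open>z\<close> to
      \<open>?V\<close>.\<close>
    let ?V = "T - {x} \<union> Y"
    have VG: "?V \<subseteq> G" using T(2) YG by blast
    have "?V \<inter> A0 = T - {x}" using A0(2,3) by blast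
    then have "card (?V \<inter> A0) < t" using cT[OF x(1)] by simp
    moreover have "?B x \<subseteq> \<F>" "\<And>F. F \<in> ?B x \<Longrightarrow> ?V \<subseteq> F" by auto
    ultimately obtain z where z: "z \<in> A0" "z \<notin> ?V" "card (?B x) \<le> c * card {F \<in> ?B x. z \<in> F}"
      using branch[OF FH int, of "?B x" ?V A0] A0(1) by blast
    let ?b = "deg (insert z ?V) (insert z ?V)"
    have "card {F \<in> ?B x. z \<in> F} \<le> ?b" by (rule card_le_deg_self) (use FH in auto)
    then have "card (?B x) \<le> c * ?b" using z(3) by (meson le_trans mult_le_mono2)
    then have cardN: "card ?N \<le> t * (c * ?b)" using x(2) unfolding T(1) by (meson le_trans mult_le_mono2)
    have zG: "z \<in> G" using z(1) A0(1) FH member_sub by blast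
    have ratV: "(1 + L) * ?b \<le> deg ?V ?V" using deg_ratio_self[OF zG z(2) VG] .
    have ratTY: "(1 + L) * deg (T \<union> Y) (T \<union> Y) \<le> deg ?V ?V"
      by (rule deg_self_ratio) (use x(1) YT T(2) YG in auto)
    \<comment> \<open>\<open>?P\<close> lies in both comparison families. The surplus
      \<open>?D\<close> for \<open>Y\<close> will dominate the members missing a point of
      \<open>T\<close>; the surplus \<open>?E\<close> for \<open>insert y' Y\<close> will dominate
      \<open>A\<close>.\<close>
    let ?P = "{F \<in> H. T \<subseteq> F \<and> F \<inter> Y \<noteq> {}}" and ?D = "{F \<in> H. F \<inter> T = T - {x} \<and> Y \<subseteq> F}"
    have PD: "card ?P + card ?D \<le> card (cross T Y)"
    proof -
      have "card ?P + card ?D = card (?P \<union> ?D)"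
        by (rule card_Un_disjoint[symmetric]) (use finite_H x(1) in auto)
      also have "\<dots> \<le> card (cross T Y)"
        by (rule card_mono[OF finite_cross]) (use x(1) in \<open>auto simp: cross_family_def\<close>)
      finally show ?thesis .
    qed
    have "deg ?V ?V \<le> card ?D + deg (T \<union> Y) (T \<union> Y)"
    proof -
      have "{F \<in> H. ?V \<subseteq> F} \<subseteq> ?D \<union> {F \<in> H. T \<union> Y \<subseteq> F}" by blast
      then have "deg ?V ?V \<le> card (?D \<union> {F \<in> H. T \<union> Y \<subseteq> F})"
        unfolding deg_self using finite_H by (intro card_mono) auto
      also have "\<dots> \<le> card ?D + deg (T \<union> Y) (T \<union> Y)" unfolding deg_self by (rule card_Un_le)
      finally show ?thesis .
    qed
    then have D1: "L * ?b \<le> card ?D" using gap[OF ratV ratTY] by linarith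
    have "?B x \<subseteq> ?D" using FH by blast
    then have "card (?B x) \<le> card ?D" using finite_H by (intro card_mono) auto
    then have D0: "0 < card ?D" using posB by linarith
    let ?E = "{F \<in> H. insert y' T \<subseteq> F \<and> F \<inter> Y = {}}"
    have y'G: "y' \<in> G" using y'(1) member_sub[OF B0H] by blast
    have PE: "card ?P + card ?E \<le> card (cross T (insert y' Y))"
    proof -
      have "card ?P + card ?E = card (?P \<union> ?E)"
        by (rule card_Un_disjoint[symmetric]) (use finite_H in auto)
      also have "\<dots> \<le> card (cross T (insert y' Y))"
        by (rule card_mono[OF finite_cross]) (auto simp: cross_family_def)
      finally show ?thesis .
    qed
    \<comment> \<open>The surplus is of order \<open>L * deg W W\<close>, against at most
      \<open>c * c * deg W W\<close> for \<open>A\<close>.\<close>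
    have E1: "(1 + L - c) * deg W W \<le> card ?E"
    proof -
      have "(1 + L) * ((1 + L - c) * deg W W) = (1 + L - c) * ((1 + L) * deg W W)"
        by (simp only: mult_ac)
      also have "\<dots> \<le> (1 + L - c) * deg (insert y' T) (insert y' T)" using ratW by (rule mult_le_mono2)
      also have "\<dots> \<le> (1 + L) * card ?E"
        by (rule deg_avoid_lower) (use T(2) y'G YG YT y'Y cardYc in auto)
      finally show ?thesis using mult_le_cancel1[of "1 + L" "(1 + L - c) * deg W W" "card ?E"] by linarith
    qed
    have good': "good_pair T (insert y' Y)"
    proof (rule good_pairI[OF T(2) _ _ _ x0(1) _ T(1)])
      show "insert y' Y \<subseteq> G" using y'G YG by blast
      show "T \<inter> insert y' Y = {}" using YT y'(2) by blast
      show "adm (T \<union> {v})" if v: "v \<in> insert y' Y" for v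
      proof (cases "v = y'")
        case True then show ?thesis using adm_subset[OF admW W(1)] by simp
      next
        case False then show ?thesis using v admT by blast
      qed
      \<comment> \<open>The witness \<open>x0\<close> survives because \<open>y'\<close> was found
        inside \<open>B0\<close>.\<close>
      show "adm (T - {x0} \<union> insert y' Y)" by (rule adm_subset_member[OF B0H]) (use x0 y'(1) in blast)
      show "2 \<le> card (insert y' Y)" using cardY card_insert_le[of Y y'] by linarith
    qed
    have "card \<F> \<le> card ?P + card A + card ?N"
    proof -
      have "\<F> \<subseteq> ?P \<union> A \<union> ?N" using FH unfolding A_def by blast
      then have "card \<F> \<le> card (?P \<union> A \<union> ?N)" using finite_H finA finF by (intro card_mono) auto
      also have "\<dots> \<le> card (?P \<union> A) + card ?N" by (rule card_Un_le)
      also have "card (?P \<union> A) \<le> card ?P + card A" by (rule card_Un_le)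
      finally show ?thesis by simp
    qed
    then have up: "card \<F> \<le> card ?P + c * (c * deg W W) + t * (c * ?b)" using cardA cardN by linarith
    have w1: "3 * (c * (c * deg W W)) \<le> (1 + L - c) * deg W W"
    proof -
      have "3 * c * c \<le> 1 + L - c"
        using L_ge5 L_ge_c unfolding power2_eq_square by linarith
      then have "(3 * c * c) * deg W W \<le> (1 + L - c) * deg W W" by (rule mult_right_mono) simp
      then show ?thesis by (simp only: mult.assoc)
    qed
    have w2: "3 * (t * (c * ?b)) \<le> L * ?b"
    proof -
      have "3 * t * c \<le> 18 * (t + 1) * c" by (rule mult_right_mono) auto
      then have "3 * t * c \<le> L" using L_ge4 by linarith
      then have "(3 * t * c) * ?b \<le> L * ?b" by (rule mult_right_mono) simp
      then show ?thesis by (simp only: mult.assoc)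
    qed
    have "card \<F> < card (cross T Y) \<or> card \<F> < card (cross T (insert y' Y))"
      by (rule exceeds_one[OF up le_trans[OF w1 E1] le_trans[OF w2 D1] PE PD D0])
    then show ?thesis using good good' by blast
  qed
qed

section \<open>Case distinction for maximal families and reduction to them\<close>

lemma main_bound_maximal:
  assumes FH: "\<F> \<subseteq> H" and int: "t_intersecting t \<F>" and nt: "\<not> t_trivial p X t \<F>"
    and max: "\<And>E. E \<in> H \<Longrightarrow> cover \<F> E \<Longrightarrow> E \<in> \<F>"
  shows "\<exists>T Y. good_pair T Y \<and> (card \<F> < card (cross T Y) \<or> \<F> \<subseteq> cross T Y)"
proof (cases "\<exists>S. adm S \<and> card S = t + 1 \<and> cover \<F> S")
  case False
  then show ?thesis using no_small_cover_case[OF FH int nt] by blast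
next
  case True
  then obtain S1 where S1: "adm S1" "card S1 = t + 1" "cover \<F> S1" by blast
  show ?thesis
  proof (cases "\<exists>S. adm S \<and> card S = t + 1 \<and> cover \<F> S \<and> S \<noteq> S1")
    case False
    then show ?thesis using unique_cover_case[OF FH int nt S1] by blast
  next
    case True
    then obtain S2 where S2: "adm S2" "card S2 = t + 1" "cover \<F> S2" "S2 \<noteq> S1" by blast
    let ?T = "S1 \<inter> S2"
    have fin: "finite S1" "finite S2"
      using finite_sub_ground[OF adm_sub[OF S1(1)]] finite_sub_ground[OF adm_sub[OF S2(1)]] .
    have "t \<le> card ?T" using maximal_covers_intersect[OF max S1(1,3) S2(1,3)] .
    moreover have "card ?T < t + 1"
    proof (rule ccontr)
      assume "\<not> card ?T < t + 1"
      then have "card S1 \<le> card ?T" "card S2 \<le> card ?T" using S1(2) S2(2) by simp_all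
      then have "?T = S1" "?T = S2"
        using card_seteq[OF fin(1) Int_lower1] card_seteq[OF fin(2) Int_lower2] by blast+
      then show False using S2(4) by metis
    qed
    ultimately have T: "card ?T = t" by linarith
    obtain y1 where y1: "y1 \<in> S1" "y1 \<notin> S2" "insert y1 ?T = S1"
      using insert_Int_eq[OF fin(1), of S2] S1(2) T by auto
    obtain y2 where y2: "y2 \<in> S2" "y2 \<notin> S1" "insert y2 ?T = S2"
      using insert_Int_eq[OF fin(2), of S1] S2(2) T by (auto simp: Int_commute)
    have y: "y1 \<notin> ?T" "y2 \<notin> ?T" "y1 \<noteq> y2" using y1 y2 by blast+
    have TG: "?T \<subseteq> G" using adm_sub[OF S1(1)] by blast
    have c1: "adm (insert y1 ?T)" "cover \<F> (insert y1 ?T)"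
      and c2: "adm (insert y2 ?T)" "cover \<F> (insert y2 ?T)"
      by (simp_all only: y1(3) y2(3) S1(1,3) S2(1,3))
    have i1: "t \<le> card (insert y1 ?T \<inter> S)" if "adm S" "cover \<F> S" for S
      using maximal_covers_intersect[OF max c1 that] .
    have i2: "t \<le> card (insert y2 ?T \<inter> S)" if "adm S" "cover \<F> S" for S
      using maximal_covers_intersect[OF max c2 that] .
    show ?thesis
    proof (cases "\<exists>S. adm S \<and> card S = t + 1 \<and> cover \<F> S \<and> \<not> ?T \<subseteq> S")
      case True
      then obtain S where S: "adm S" "card S = t + 1" "cover \<F> S" "\<not> ?T \<subseteq> S" by blast
      show ?thesis
        using crossing_covers_case[OF T TG y c1 c2 S i1[OF S(1,3)] i2[OF S(1,3)] FH] by blast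
    next
      case False
      show ?thesis
        by (rule common_kernel_case[OF FH int nt T TG _ y c1 c2]) (use False in blast)
    qed
  qed
qed

text \<open>A maximal \<open>t\<close>-intersecting family above \<open>\<F>\<close> is again
  nontrivial and contains every member of \<open>H\<close> that is a cover of it; both alternatives
  of the conclusion pass down to \<open>\<F>\<close>.\<close>

lemma main_bound:
  assumes FH: "\<F> \<subseteq> H" and int: "t_intersecting t \<F>" and nt: "\<not> t_trivial p X t \<F>"
  shows "\<exists>T Y. good_pair T Y \<and> (card \<F> < card (cross T Y) \<or> \<F> \<subseteq> cross T Y)"
proof -
  let ?Q = "{\<E>. \<F> \<subseteq> \<E> \<and> \<E> \<subseteq> H \<and> t_intersecting t \<E>}"
  have "finite ?Q" by (rule finite_subset[of _ "Pow H"]) (auto simp: finite_H)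
  moreover have "\<F> \<in> ?Q" using FH int by blast
  ultimately obtain \<M> where M: "\<M> \<in> ?Q" "\<forall>\<E>\<in>?Q. \<M> \<subseteq> \<E> \<longrightarrow> \<M> = \<E>"
    using finite_has_maximal[of ?Q] by blast
  have "\<not> t_trivial p X t \<M>" using nt M(1) unfolding t_trivial_def by blast
  moreover have "E \<in> \<M>" if E: "E \<in> H" "cover \<M> E" for E
  proof -
    \<comment> \<open>That \<open>E\<close> meets itself in at least \<open>t\<close> points comes
      from \<open>K_ge\<close>.\<close>
    have "t_intersecting t (insert E \<M>)"
      using M(1) E card_member_K[OF E(1)] K_ge
      by (auto simp: t_intersecting_def cover_def Int_commute)
    then have "insert E \<M> \<in> ?Q" using M(1) E(1) by blast
    then have "\<M> \<subseteq> insert E \<M> \<longrightarrow> \<M> = insert E \<M>" by (rule bspec[OF M(2)])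
    then have "\<M> = insert E \<M>" by (simp add: subset_insertI)
    then show ?thesis by (rule ssubst) simp
  qed
  moreover have sub: "\<F> \<subseteq> \<M>" "\<M> \<subseteq> H" "t_intersecting t \<M>" using M(1) by simp_all
  ultimately obtain T Y where TY: "good_pair T Y" "card \<M> < card (cross T Y) \<or> \<M> \<subseteq> cross T Y"
    using main_bound_maximal[of \<M>] by blast
  have "card \<F> \<le> card \<M>" by (rule card_mono[OF finite_subset[OF sub(2) finite_H] sub(1)])
  then have "card \<F> < card (cross T Y) \<or> \<F> \<subseteq> cross T Y" using TY(2) sub(1) by auto
  then show ?thesis using TY(1) by blast
qed

section \<open>Optimal pairs\<close>

lemma good_pairD:
  assumes "good_pair T Y"
  shows "T \<subseteq> G" "Y \<subseteq> G" "T \<inter> Y = {}" "\<And>y. y \<in> Y \<Longrightarrow> adm (T \<union> {y})"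
    "\<exists>x\<in>T. adm (T - {x} \<union> Y)" "card T = t" "2 \<le> card Y"
  using assms unfolding good_pair_def feasible_pair_def by blast+

text \<open>The trace on \<open>T\<close> separates the pieces, and the piece of \<open>x\<close>
  consists of the members with trace \<open>T - {x} \<union> Y\<close> on
  \<open>T \<union> Y\<close>.\<close>

lemma card_cross_split:
  assumes "T \<subseteq> G" "Y \<subseteq> G" "T \<inter> Y = {}"
  shows "card (cross T Y) = card {F \<in> H. T \<subseteq> F \<and> F \<inter> Y \<noteq> {}} + (\<Sum>x\<in>T. deg (T \<union> Y) (T - {x} \<union> Y))"
proof -
  let ?P = "{F \<in> H. T \<subseteq> F \<and> F \<inter> Y \<noteq> {}}" and ?D = "\<lambda>x. {F \<in> H. F \<inter> T = T - {x} \<and> Y \<subseteq> F}"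
  have finT: "finite T" using finite_sub_ground[OF assms(1)] .
  have fin: "finite (?D x)" for x using finite_H by simp
  have "cross T Y = ?P \<union> (\<Union>x\<in>T. ?D x)" by (auto simp: cross_family_def)
  moreover have "?P \<inter> (\<Union>x\<in>T. ?D x) = {}" by blast
  ultimately have "card (cross T Y) = card ?P + card (\<Union>x\<in>T. ?D x)"
    using finite_H finT by (simp add: card_Un_disjoint)
  also have "card (\<Union>x\<in>T. ?D x) = (\<Sum>x\<in>T. card (?D x))"
    by (rule card_UN_disjoint[OF finT]) (use fin in auto)
  also have "\<dots> = (\<Sum>x\<in>T. deg (T \<union> Y) (T - {x} \<union> Y))"
  proof (rule sum.cong[OF refl])
    fix x assume "x \<in> T"
    then have "(F \<inter> T = T - {x} \<and> Y \<subseteq> F) \<longleftrightarrow> F \<inter> (T \<union> Y) = T - {x} \<union> Y" for F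
      using assms(3) by blast
    then show "card (?D x) = deg (T \<union> Y) (T - {x} \<union> Y)" unfolding deg_def by simp
  qed
  finally show ?thesis .
qed

lemma card_trace_union:
  assumes "T \<subseteq> G" "Y \<subseteq> G" "T \<inter> Y = {}"
  shows "card ((T \<union> Y) \<inter> X i) = card (T \<inter> X i) + card (Y \<inter> X i)"
proof -
  have "(T \<union> Y) \<inter> X i = (T \<inter> X i) \<union> (Y \<inter> X i)" by blast
  moreover have "finite (T \<inter> X i)" "finite (Y \<inter> X i)"
    using finite_sub_ground[OF assms(1)] finite_sub_ground[OF assms(2)] by simp_all
  moreover have "(T \<inter> X i) \<inter> (Y \<inter> X i) = {}" using assms(3) by blast
  ultimately show ?thesis by (simp only: card_Un_disjoint)
qed

lemma card_trace_swap:
  assumes "T \<subseteq> G" "Y \<subseteq> G" "T \<inter> Y = {}" "x \<in> T" "h \<in> {1..p}" "x \<in> X h" "j \<in> {1..p}"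
  shows "card ((T - {x} \<union> Y) \<inter> X j) + (if j = h then 1 else 0) = card (T \<inter> X j) + card (Y \<inter> X j)"
proof -
  have "T = insert x (T - {x})" using assms(4) by blast
  then have "card (T \<inter> X j) = card (insert x (T - {x}) \<inter> X j)" by simp
  also have "\<dots> = card ((T - {x}) \<inter> X j) + (if j = h then 1 else 0)"
    by (rule card_insert_block[OF assms(5,6) _ _ assms(7)]) (use assms(1) in auto)
  finally have "card (T \<inter> X j) = card ((T - {x}) \<inter> X j) + (if j = h then 1 else 0)" .
  moreover have "card ((T - {x} \<union> Y) \<inter> X j) = card ((T - {x}) \<inter> X j) + card (Y \<inter> X j)"
    by (rule card_trace_union) (use assms(1-3) in auto)
  ultimately show ?thesis by linarith
qed

text \<open>Members through \<open>T\<close> that meet \<open>Y\<close> are counted by complement.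
  In the second part the degree depends on \<open>x\<close> only through its block, which gives the
  weights \<open>card (T \<inter> X i)\<close>.\<close>

lemma card_cross:
  assumes "T \<subseteq> G" "Y \<subseteq> G" "T \<inter> Y = {}"
  shows "int (card (cross T Y)) = cross_size p n k (pair_profile p X T Y)"
proof -
  let ?a = "\<lambda>i. card (T \<inter> X i)" and ?l = "\<lambda>i. card (Y \<inter> X i)"
  let ?I = "{1..p}"
  have finT: "finite T" using finite_sub_ground[OF assms(1)] .
  have TY: "T \<union> Y \<subseteq> G" using assms by blast
  note uni = card_trace_union[OF assms]
  have first: "int (card {F \<in> H. T \<subseteq> F \<and> F \<inter> Y \<noteq> {}}) =
      (\<Prod>i=1..p. int_binom (int (n i) - int (?a i)) (int (k i) - int (?a i)))
    - (\<Prod>i=1..p. int_binom (int (n i) - int (?a i) - int (?l i)) (int (k i) - int (?a i)))"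
  proof -
    have "{F \<in> H. T \<subseteq> F} = {F \<in> H. T \<subseteq> F \<and> F \<inter> Y \<noteq> {}} \<union> {F \<in> H. F \<inter> (T \<union> Y) = T}"
      using assms(3) by blast
    moreover have "{F \<in> H. T \<subseteq> F \<and> F \<inter> Y \<noteq> {}} \<inter> {F \<in> H. F \<inter> (T \<union> Y) = T} = {}"
      using assms(3) by blast
    ultimately have "deg T T = card {F \<in> H. T \<subseteq> F \<and> F \<inter> Y \<noteq> {}} + deg (T \<union> Y) T"
      unfolding deg_self unfolding deg_def using finite_H by (simp add: card_Un_disjoint)
    then have "int (card {F \<in> H. T \<subseteq> F \<and> F \<inter> Y \<noteq> {}}) = int (deg T T) - int (deg (T \<union> Y) T)" by simp
    then show ?thesis
      unfolding deg_formula[OF assms(1) order.refl] deg_formula[OF TY Un_upper1] uni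
      by (simp only: of_nat_add diff_diff_eq)
  qed
  define w where "w i = int_binom (int (n i) - int (?a i) - int (?l i)) (int (k i) - int (?a i) - int (?l i) + 1)
    * (\<Prod>j\<in>?I - {i}. int_binom (int (n j) - int (?a j) - int (?l j)) (int (k j) - int (?a j) - int (?l j)))" for i
  have D: "int (deg (T \<union> Y) (T - {x} \<union> Y)) = w i" if x: "x \<in> T" and i: "i \<in> ?I" "x \<in> X i" for x i
  proof -
    have sub: "T - {x} \<union> Y \<subseteq> T \<union> Y" by blast
    note swap = card_trace_swap[OF assms x i]
    let ?f = "\<lambda>j. int_binom (int (n j) - int (card ((T \<union> Y) \<inter> X j))) (int (k j) - int (card ((T - {x} \<union> Y) \<inter> X j)))"
    have "int (deg (T \<union> Y) (T - {x} \<union> Y)) = ?f i * (\<Prod>j\<in>?I - {i}. ?f j)"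
      unfolding deg_formula[OF TY sub] by (rule prod.remove) (use i in auto)
    moreover have "?f i = int_binom (int (n i) - int (?a i) - int (?l i)) (int (k i) - int (?a i) - int (?l i) + 1)"
      by (rule arg_cong2[where f = int_binom]) (use swap[OF i(1)] uni[of i] in auto)
    moreover have "(\<Prod>j\<in>?I - {i}. ?f j) =
      (\<Prod>j\<in>?I - {i}. int_binom (int (n j) - int (?a j) - int (?l j)) (int (k j) - int (?a j) - int (?l j)))"
    proof (rule prod.cong[OF refl])
      fix j assume j: "j \<in> ?I - {i}"
      show "?f j = int_binom (int (n j) - int (?a j) - int (?l j)) (int (k j) - int (?a j) - int (?l j))"
        by (rule arg_cong2[where f = int_binom]) (use swap[of j] j uni[of j] in auto)
    qed
    ultimately show ?thesis unfolding w_def by simp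
  qed
  have "T = (\<Union>i\<in>?I. T \<inter> X i)" using assms(1) by (auto simp: ground_set_def)
  then have "(\<Sum>x\<in>T. int (deg (T \<union> Y) (T - {x} \<union> Y))) = (\<Sum>x\<in>(\<Union>i\<in>?I. T \<inter> X i). int (deg (T \<union> Y) (T - {x} \<union> Y)))"
    by simp
  also have "\<dots> = (\<Sum>i\<in>?I. \<Sum>x\<in>T \<inter> X i. int (deg (T \<union> Y) (T - {x} \<union> Y)))"
  proof (rule sum.UNION_disjoint)
    show "\<forall>i\<in>?I. \<forall>j\<in>?I. i \<noteq> j \<longrightarrow> T \<inter> X i \<inter> (T \<inter> X j) = {}" using block_eq by blast
  qed (use finT in auto)
  also have "\<dots> = (\<Sum>i\<in>?I. int (?a i) * w i)"
  proof (rule sum.cong[OF refl])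
    fix i assume i: "i \<in> ?I"
    have "(\<Sum>x\<in>T \<inter> X i. int (deg (T \<union> Y) (T - {x} \<union> Y))) = (\<Sum>x\<in>T \<inter> X i. w i)"
      by (rule sum.cong[OF refl]) (use D i in blast)
    then show "(\<Sum>x\<in>T \<inter> X i. int (deg (T \<union> Y) (T - {x} \<union> Y))) = int (?a i) * w i" by simp
  qed
  finally have second: "(\<Sum>x\<in>T. int (deg (T \<union> Y) (T - {x} \<union> Y))) = (\<Sum>i\<in>?I. int (?a i) * w i)" .
  have "cross_size p n k (pair_profile p X T Y) =
      (\<Prod>i=1..p. int_binom (int (n i) - int (?a i)) (int (k i) - int (?a i)))
    - (\<Prod>i=1..p. int_binom (int (n i) - int (?a i) - int (?l i)) (int (k i) - int (?a i)))
    + (\<Sum>i\<in>?I. int (?a i) * w i)"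
    unfolding cross_size_def pair_profile_def w_def by (simp add: mult.assoc)
  then show ?thesis using card_cross_split[OF assms] first second by simp
qed

section \<open>The shape of an optimal pair\<close>

lemma good_pair_card:
  assumes "good_pair T Y"
  shows "card (T \<union> Y) < 2 * K"
proof -
  note g = good_pairD[OF assms]
  obtain x where x: "x \<in> T" "adm (T - {x} \<union> Y)" using g(5) by blast
  have "card Y \<le> K" using adm_card_K[OF adm_subset[OF x(2) Un_upper2]] .
  moreover have "card (T \<union> Y) \<le> card T + card Y" by (rule card_Un_le)
  ultimately show ?thesis using g(6) K_ge by linarith
qed

text \<open>As a function of the number of elements of \<open>Y\<close> in one block, the size of the cross family
  has no local maximum in the interior: enlarging \<open>Y\<close> can only fail to help if the second part of
  the family is comparable with the gain, and then removing a point multiplies that part by a large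
  factor.\<close>

lemma interior_not_optimal:
  assumes good: "good_pair T Y" and "3 \<le> card Y"
    and i: "i \<in> {1..p}" and y0: "y0 \<in> Y" "y0 \<in> X i" and y: "y \<in> X i" "y \<notin> T" "y \<notin> Y"
    and good': "good_pair T (insert y Y)"
  shows "\<exists>Y'. good_pair T Y' \<and> card (cross T Y) < card (cross T Y')"
proof -
  note g = good_pairD[OF good]
  note g' = good_pairD[OF good']
  have finY: "finite Y" using finite_sub_ground[OF g(2)] .
  have finT: "finite T" using finite_sub_ground[OF g(1)] .
  let ?Y' = "Y - {y0}"
  have good'': "good_pair T ?Y'"
  proof -
    obtain x where x: "x \<in> T" "adm (T - {x} \<union> Y)" using g(5) by blast
    show ?thesis
    proof (rule good_pairI[OF g(1) _ _ _ x(1) _ g(6)])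
      show "adm (T - {x} \<union> ?Y')" by (rule adm_subset[OF x(2)]) blast
      show "2 \<le> card ?Y'" using assms(2) y0(1) finY by simp
      show "adm (T \<union> {v})" if "v \<in> ?Y'" for v using g(4) that by blast
    qed (use g in auto)
  qed
  note g'' = good_pairD[OF good'']
  let ?P = "\<lambda>Y. card {F \<in> H. T \<subseteq> F \<and> F \<inter> Y \<noteq> {}}"
  let ?D = "\<lambda>Y. \<Sum>x\<in>T. deg (T \<union> Y) (T - {x} \<union> Y)"
  let ?gain = "deg (insert y (T \<union> Y)) (insert y T)" and ?loss = "deg (T \<union> Y) (insert y0 T)"
  have gain: "?P (insert y Y) = ?P Y + ?gain"
  proof -
    have "{F \<in> H. T \<subseteq> F \<and> F \<inter> insert y Y \<noteq> {}} =
      {F \<in> H. T \<subseteq> F \<and> F \<inter> Y \<noteq> {}} \<union> {F \<in> H. F \<inter> insert y (T \<union> Y) = insert y T}"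
      using g(3) y(2,3) by auto
    moreover have "{F \<in> H. T \<subseteq> F \<and> F \<inter> Y \<noteq> {}} \<inter> {F \<in> H. F \<inter> insert y (T \<union> Y) = insert y T} = {}"
      using g(3) y(2,3) by auto
    ultimately show ?thesis unfolding deg_def using finite_H by (simp add: card_Un_disjoint)
  qed
  have loss: "?P Y = ?P ?Y' + ?loss"
  proof -
    have "{F \<in> H. T \<subseteq> F \<and> F \<inter> Y \<noteq> {}} =
      {F \<in> H. T \<subseteq> F \<and> F \<inter> ?Y' \<noteq> {}} \<union> {F \<in> H. F \<inter> (T \<union> Y) = insert y0 T}"
      using g(3) y0(1) by auto
    moreover have "{F \<in> H. T \<subseteq> F \<and> F \<inter> ?Y' \<noteq> {}} \<inter> {F \<in> H. F \<inter> (T \<union> Y) = insert y0 T} = {}"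
      using g(3) y0(1) by auto
    ultimately show ?thesis unfolding deg_def using finite_H by (simp add: card_Un_disjoint)
  qed
  have TYG: "T \<union> Y \<subseteq> G" using g(1,2) by blast
  have yG: "y \<in> G" using y(1) block_sub[OF i] by blast
  \<comment> \<open>The lost members avoiding \<open>y\<close> are as many as the gained ones, since
    \<open>y\<close> and \<open>y0\<close> share a block; those containing \<open>y\<close> are a
    small fraction.\<close>
  have loss_gain: "?loss \<le> 2 * ?gain"
  proof -
    let ?f = "deg (insert y (T \<union> Y)) (insert y (insert y0 T))"
    have yTY: "y \<notin> T \<union> Y" using y by blast
    have y0T: "insert y0 T \<subseteq> T \<union> Y" using y0(1) by blast
    have split: "?loss = ?f + deg (insert y (T \<union> Y)) (insert y0 T)" by (rule deg_split[OF yTY y0T])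
    have y0nT: "y0 \<notin> T" using y0(1) g(3) by blast
    have "deg (insert y (T \<union> Y)) (insert y0 T) = ?gain"
    proof (rule deg_cong_profile)
      fix j assume j: "j \<in> {1..p}"
      show "card (insert y0 T \<inter> X j) = card (insert y T \<inter> X j)"
        using card_insert_block[OF i y0(2) y0nT g(1) j] card_insert_block[OF i y(1,2) g(1) j] by simp
    qed (use TYG yG y0T in auto)
    then have eq: "?loss = ?f + ?gain" using split by simp
    have "(L - 1) * ?f \<le> ?loss"
      by (rule deg_ratio_general[OF yG yTY TYG y0T]) (use good_pair_card[OF good] in simp)
    moreover have "2 * ?f \<le> (L - 1) * ?f" using L_ge by (intro mult_right_mono) auto
    ultimately show ?thesis using eq by linarith
  qed
  have D_ratio: "(L - 1) * ?D Y \<le> ?D ?Y'"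
  proof -
    have "(L - 1) * deg (T \<union> Y) (T - {x} \<union> Y) \<le> deg (T \<union> ?Y') (T - {x} \<union> ?Y')" if x: "x \<in> T" for x
    proof -
      have e: "T \<union> Y = insert y0 (T \<union> ?Y')" "T - {x} \<union> Y = insert y0 (T - {x} \<union> ?Y')"
        using y0(1) by blast+
      show ?thesis unfolding e
        by (rule deg_ratio_general) (use y0(1) g(1-3) good_pair_card[OF good''] in auto)
    qed
    then show ?thesis unfolding sum_distrib_left by (rule sum_mono)
  qed
  have D_pos: "0 < ?D Y"
  proof -
    obtain x where x: "x \<in> T" "adm (T - {x} \<union> Y)" using g(5) by blast
    have "0 < deg (T \<union> Y) (T - {x} \<union> Y)"
      by (rule deg_pos[OF TYG _ x(2)]) (use good_pair_card[OF good] in auto)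
    also have "\<dots> \<le> ?D Y" by (rule member_le_sum[OF x(1)]) (use finT in auto)
    finally show ?thesis .
  qed
  \<comment> \<open>If adding \<open>y\<close> does not help, then \<open>?gain \<le> ?D Y\<close>
    and so \<open>?loss \<le> 2 * ?D Y\<close>, whereas deleting \<open>y0\<close> raises the second
    part by at least \<open>3 * ?D Y\<close>.\<close>
  have "4 * ?D Y \<le> (L - 1) * ?D Y" using L_ge by (intro mult_right_mono) auto
  then have "card (cross T Y) < card (cross T (insert y Y)) \<or> card (cross T Y) < card (cross T ?Y')"
    using gain loss loss_gain D_ratio D_pos card_cross_split[OF g(1-3)] card_cross_split[OF g'(1-3)]
      card_cross_split[OF g''(1-3)] by linarith
  then show ?thesis using good' good'' by blast
qed

text \<open>For \<open>card Y \<ge> 3\<close>, \<open>interior_not_optimal\<close> makes every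
  admissible \<open>T - {x} \<union> Y\<close> full in each block that \<open>Y\<close> meets. If
  \<open>Y\<close> meets the block \<open>h\<close> of the removed point, the third shape results,
  otherwise the second.\<close>

lemma optimal_shape:
  assumes good: "good_pair T Y"
    and opt: "\<And>T' Y'. good_pair T' Y' \<Longrightarrow> card (cross T' Y') \<le> card (cross T Y)"
  shows "extremal_shape p k (\<lambda>i\<in>{1..p}. card (T \<inter> X i)) (\<lambda>i\<in>{1..p}. card (Y \<inter> X i))"
proof -
  note g = good_pairD[OF good]
  define a where "a = (\<lambda>i\<in>{1..p}. card (T \<inter> X i))"
  define l where "l = (\<lambda>i\<in>{1..p}. card (Y \<inter> X i))"
  have a: "a i = card (T \<inter> X i)" and l: "l i = card (Y \<inter> X i)" if "i \<in> {1..p}" for i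
    using that by (simp_all add: a_def l_def)
  have suml: "(\<Sum>i=1..p. l i) = card Y" using card_split_blocks[OF g(2)] by (simp add: l_def)
  have finT: "finite T" and finY: "finite Y" using finite_sub_ground g(1,2) by blast+
  have "extremal_shape p k a l"
  proof (cases "card Y = 2")
    case True
    then show ?thesis using suml by (simp add: extremal_shape_def)
  next
    case False
    then have Y3: "3 \<le> card Y" using g(7) by simp
    have swap: "card ((T - {x} \<union> Y) \<inter> X j) + (if j = h then 1 else 0) = a j + l j"
      if "x \<in> T" "h \<in> {1..p}" "x \<in> X h" "j \<in> {1..p}" for x h j
      using card_trace_swap[OF g(1-3) that] a l that(4) by simp
    have full: "card ((T - {x} \<union> Y) \<inter> X i) = k i"
      if x: "x \<in> T" "adm (T - {x} \<union> Y)" and i: "i \<in> {1..p}" "0 < l i" for x i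
    proof (rule ccontr)
      assume ne: "card ((T - {x} \<union> Y) \<inter> X i) \<noteq> k i"
      have le: "card ((T - {x} \<union> Y) \<inter> X j) \<le> k j" if "j \<in> {1..p}" for j
        using x(2) that by (auto simp: admissible_set_def)
      have "Y \<inter> X i \<noteq> {}" using i l[OF i(1)] by auto
      then obtain y0 where y0: "y0 \<in> Y" "y0 \<in> X i" by blast
      have "card (T \<union> Y) < card (X i)"
      proof -
        have "K * 2 \<le> K * (1 + L)" using L_ge by (intro mult_le_mono2) simp
        then show ?thesis using good_pair_card[OF good] n_large[OF i(1)] card_block[OF i(1)] by linarith
      qed
      then have "\<not> X i \<subseteq> T \<union> Y" using card_mono[of "T \<union> Y" "X i"] finT finY by auto
      then obtain y where y: "y \<in> X i" "y \<notin> T" "y \<notin> Y" by blast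
      have yG: "y \<in> G" using y(1) block_sub[OF i(1)] by blast
      have VG: "T - {x} \<union> Y \<subseteq> G" and yV: "y \<notin> T - {x} \<union> Y" using g(1,2) y by auto
      have "good_pair T (insert y Y)"
      proof (rule good_pairI[OF g(1) _ _ _ x(1) _ g(6)])
        show "insert y Y \<subseteq> G" using g(2) yG by blast
        show "T \<inter> insert y Y = {}" using g(3) y(2) by blast
        show "2 \<le> card (insert y Y)" using Y3 card_insert_le[of Y y] by linarith
        \<comment> \<open>The new point \<open>y\<close> shares its block with \<open>y0\<close>, so
          \<open>insert y T\<close> has the profile of \<open>insert y0 T\<close>.\<close>
        show "adm (T \<union> {v})" if v: "v \<in> insert y Y" for v
        proof (cases "v = y")
          case True
          have y0T: "y0 \<notin> T" using y0(1) g(3) by blast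
          have "card (insert y T \<inter> X j) \<le> k j" if j: "j \<in> {1..p}" for j
          proof -
            have "card (insert y T \<inter> X j) = card (insert y0 T \<inter> X j)"
              using card_insert_block[OF i(1) y0(2) y0T g(1) j] card_insert_block[OF i(1) y(1,2) g(1) j] by simp
            also have "\<dots> \<le> k j" using g(4)[OF y0(1)] j by (simp add: admissible_set_def)
            finally show ?thesis .
          qed
          then show ?thesis using True g(1) yG by (simp add: admissible_set_def)
        next
          case False then show ?thesis using v g(4) by blast
        qed
        have "card (insert y (T - {x} \<union> Y) \<inter> X j) \<le> k j" if j: "j \<in> {1..p}" for j
          using card_insert_block[OF i(1) y(1) yV VG j] le[OF j] ne by (cases "j = i") auto
        then have "adm (insert y (T - {x} \<union> Y))" using VG yG by (simp add: admissible_set_def)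
        then show "adm (T - {x} \<union> insert y Y)" by simp
      qed
      then obtain Y' where "good_pair T Y'" "card (cross T Y) < card (cross T Y')"
        using interior_not_optimal[OF good Y3 i(1) y0 y] by blast
      then show False using opt by (meson not_le)
    qed
    obtain x0 where x0: "x0 \<in> T" "adm (T - {x0} \<union> Y)" using g(5) by blast
    obtain h where h: "h \<in> {1..p}" "x0 \<in> X h" using x0(1) g(1) by (auto simp: ground_set_def)
    \<comment> \<open>The extra 1 in block \<open>h\<close> stands for the removed point
      \<open>x0\<close>.\<close>
    have eq: "a i + l i = k i + (if i = h then 1 else 0)" if "i \<in> {1..p}" "0 < l i" for i
      using full[OF x0 that] swap[OF x0(1) h that(1)] by simp
    have le: "a i + l i \<le> k i + (if i = h then 1 else 0)" if i: "i \<in> {1..p}" for i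
    proof -
      have "card ((T - {x0} \<union> Y) \<inter> X i) \<le> k i" using x0(2) i by (auto simp: admissible_set_def)
      then show ?thesis using swap[OF x0(1) h i] by simp
    qed
    have "card Y \<noteq> 0" using Y3 by simp
    then obtain y1 where y1: "y1 \<in> Y" by (metis card.empty equals0I)
    have admT: "adm T" using adm_subset[OF g(4)[OF y1] Un_upper1] .
    have ale: "a i \<le> k i" if "i \<in> {1..p}" for i
      using admT that a[OF that] by (simp add: admissible_set_def)
    show ?thesis
    proof (cases "0 < l h")
      case True
      have "Y \<inter> X h \<noteq> {}" using True l[OF h(1)] by auto
      then obtain v where v: "v \<in> Y" "v \<in> X h" by blast
      have vT: "v \<notin> T" using v(1) g(3) by blast
      have "card (insert v T \<inter> X h) \<le> k h" using g(4)[OF v(1)] h(1) by (simp add: admissible_set_def)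
      then have ah: "a h + 1 \<le> k h"
        using card_insert_block[OF h(1) v(2) vT g(1) h(1)] a[OF h(1)] by simp
      have ah1: "1 \<le> a h"
      proof -
        have "T \<inter> X h \<noteq> {}" using x0(1) h(2) by blast
        then have "0 < card (T \<inter> X h)" using finT by (simp add: card_gt_0_iff)
        then show ?thesis using a[OF h(1)] by simp
      qed
      have ehl: "a h + l h = k h + 1" using eq[OF h(1) True] by simp
      have others: "l i = 0 \<or> a i + l i = k i" if "i \<in> {1..p} - {h}" for i
        using eq[of i] that by auto
      have "\<exists>!h. h \<in> {1..p} \<and> 1 \<le> a h \<and> a h + 1 \<le> k h \<and> a h + l h = k h + 1 \<and>
        (\<forall>i\<in>{1..p} - {h}. l i = 0 \<or> a i + l i = k i)"
      proof (rule ex1I[of _ h])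
        show "h \<in> {1..p} \<and> 1 \<le> a h \<and> a h + 1 \<le> k h \<and> a h + l h = k h + 1 \<and>
          (\<forall>i\<in>{1..p} - {h}. l i = 0 \<or> a i + l i = k i)"
          using h(1) ah1 ah ehl others by blast
      next
        fix h' assume h': "h' \<in> {1..p} \<and> 1 \<le> a h' \<and> a h' + 1 \<le> k h' \<and> a h' + l h' = k h' + 1 \<and>
          (\<forall>i\<in>{1..p} - {h'}. l i = 0 \<or> a i + l i = k i)"
        show "h' = h"
        proof (rule ccontr)
          assume "h' \<noteq> h"
          then have "l h' = 0 \<or> a h' + l h' = k h'" using others[of h'] h' by blast
          then show False using h' by auto
        qed
      qed
      then show ?thesis using suml Y3 unfolding extremal_shape_def by simp
    next
      case False
      then have lh: "l h = 0" by simp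
      have "(l i = 0 \<or> l i = k i) \<and> a i + l i \<le> k i" if i: "i \<in> {1..p}" for i
      proof (cases "l i = 0")
        case True then show ?thesis using ale[OF i] by simp
      next
        case False
        then have li: "0 < l i" and ih: "i \<noteq> h" using lh by auto
        have ei: "a i + l i = k i" using eq[OF i li] ih by simp
        \<comment> \<open>A point \<open>x\<close> of \<open>T\<close> in block \<open>i\<close>
          could be removed instead of \<open>x0\<close>, because with \<open>l h = 0\<close> no
          block is overfull; the resulting set would not be full in block \<open>i\<close>.\<close>
        have "a i = 0"
        proof (rule ccontr)
          assume "a i \<noteq> 0"
          then have "T \<inter> X i \<noteq> {}" using a[OF i] by auto
          then obtain x where x: "x \<in> T" "x \<in> X i" by blast
          have "card ((T - {x} \<union> Y) \<inter> X j) \<le> k j" if j: "j \<in> {1..p}" for j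
          proof -
            have "a j + l j \<le> k j" using le[OF j] ale[OF j] lh by (cases "j = h") auto
            then show ?thesis using swap[OF x(1) i x(2) j] by linarith
          qed
          then have "adm (T - {x} \<union> Y)" using g(1,2) by (auto simp: admissible_set_def)
          then have "card ((T - {x} \<union> Y) \<inter> X i) = k i" by (rule full[OF x(1) _ i li])
          then show False using swap[OF x(1) i x(2) i] ei by simp
        qed
        then show ?thesis using ei by simp
      qed
      then show ?thesis using suml Y3 unfolding extremal_shape_def by simp
    qed
  qed
  then show ?thesis by (simp add: a_def l_def)
qed

section \<open>The maximum over extremal profiles and the equality case\<close>

abbreviation profile :: "'a set \<Rightarrow> 'a set \<Rightarrow> (nat \<Rightarrow> nat) \<times> (nat \<Rightarrow> nat)" where
  "profile T Y \<equiv> pair_profile p X T Y"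

text \<open>Each shape forces \<open>card Y \<ge> 2\<close>.\<close>

lemma extremal_profile_good:
  assumes "q \<in> extremal_profiles p X k t"
  shows "\<exists>T Y. good_pair T Y \<and> q = profile T Y"
proof -
  obtain a l where q: "q = (a, l)" by (cases q)
  have shape: "extremal_shape p k a l"
    and "\<exists>T Y. feasible_pair p X k T Y \<and> card T = t \<and> (a, l) = profile T Y"
    using assms unfolding q extremal_profiles_def mem_Collect_eq prod.case by (rule conjunct1, rule conjunct2)
  then obtain T Y where TY: "feasible_pair p X k T Y" "card T = t" "(a, l) = profile T Y" by blast
  have YG: "Y \<subseteq> G" using TY(1) by (simp add: feasible_pair_def)
  have "(\<Sum>i=1..p. l i) = card Y"
    using card_split_blocks[OF YG] TY(3) by (simp add: pair_profile_def)
  moreover have "2 \<le> (\<Sum>i=1..p. l i)" using shape unfolding extremal_shape_def by linarith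
  ultimately have "good_pair T Y" using TY by (simp add: good_pair_def)
  then show ?thesis using TY(3) q by blast
qed

lemma optimal_profile_extremal:
  assumes "good_pair T Y" "\<And>T' Y'. good_pair T' Y' \<Longrightarrow> card (cross T' Y') \<le> card (cross T Y)"
  shows "profile T Y \<in> extremal_profiles p X k t"
  using optimal_shape[OF assms] assms(1)
  unfolding extremal_profiles_def good_pair_def pair_profile_def by blast

lemma finite_extremal_profiles: "finite (extremal_profiles p X k t)"
proof (rule finite_subset)
  show "extremal_profiles p X k t \<subseteq> (\<lambda>(T, Y). profile T Y) ` (Pow G \<times> Pow G)"
  proof
    fix q assume "q \<in> extremal_profiles p X k t"
    then obtain T Y where "good_pair T Y" "q = profile T Y" using extremal_profile_good by blast
    then show "q \<in> (\<lambda>(T, Y). profile T Y) ` (Pow G \<times> Pow G)" using good_pairD(1,2) by blast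
  qed
qed (simp add: finite_ground)

lemma good_pair_cross_size:
  "good_pair T Y \<Longrightarrow> cross_size p n k (profile T Y) = int (card (cross T Y))"
  using card_cross good_pairD(1-3) by simp

text \<open>By finiteness there is a largest cross family of a good pair. Its profile is extremal by
  optimality and no extremal profile gives more, so \<open>M\<close> is its size.\<close>

theorem nontrivial_intersecting_bound:
  assumes FH: "\<F> \<subseteq> H" and int: "t_intersecting t \<F>" and nt: "\<not> t_trivial p X t \<F>"
  defines "M \<equiv> Max (cross_size p n k ` extremal_profiles p X k t)"
  shows "int (card \<F>) \<le> M \<and> (int (card \<F>) = M \<longleftrightarrow>
        (\<exists>T Y. feasible_pair p X k T Y \<and> card T = t \<and> card Y \<ge> 2
           \<and> is_arg_max (cross_size p n k) (\<lambda>q. q \<in> extremal_profiles p X k t) (pair_profile p X T Y)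
           \<and> \<F> = cross_family p X k T Y))"
proof -
  let ?E = "extremal_profiles p X k t"
  define Q where "Q = {TY. good_pair (fst TY) (snd TY)}"
  define size where "size TY = card (cross (fst TY) (snd TY))" for TY
  obtain T Y where TY: "good_pair T Y" "card \<F> < card (cross T Y) \<or> \<F> \<subseteq> cross T Y"
    using main_bound[OF FH int nt] by blast
  have "Q \<subseteq> Pow G \<times> Pow G"
  proof
    fix q assume "q \<in> Q"
    then have "good_pair (fst q) (snd q)" by (simp add: Q_def)
    then show "q \<in> Pow G \<times> Pow G" using good_pairD(1,2) by (simp add: mem_Times_iff)
  qed
  then have "finite Q" using finite_ground by (simp add: finite_subset)
  moreover have "(T, Y) \<in> Q" using TY(1) by (simp add: Q_def)
  ultimately have "finite (size ` Q)" "size ` Q \<noteq> {}" by auto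
  then have Max: "Max (size ` Q) \<in> size ` Q" "\<And>s. s \<in> size ` Q \<Longrightarrow> s \<le> Max (size ` Q)"
    by (rule Max_in) (rule Max_ge[OF \<open>finite (size ` Q)\<close>])
  then obtain q where qQ: "q \<in> Q" and qmax: "Max (size ` Q) = size q" by blast
  have "\<forall>q'\<in>Q. size q' \<le> size q" using Max(2)[OF imageI] unfolding qmax by blast
  note q = qQ this
  obtain T0 Y0 where q0: "q = (T0, Y0)" by (cases q)
  have good0: "good_pair T0 Y0" using q(1) by (simp add: Q_def q0)
  have max0: "card (cross T' Y') \<le> card (cross T0 Y0)" if "good_pair T' Y'" for T' Y'
    using bspec[OF q(2), of "(T', Y')"] that by (simp add: Q_def size_def q0)
  let ?m = "int (card (cross T0 Y0))"
  have upper: "cross_size p n k q \<le> ?m" if "q \<in> ?E" for q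
  proof -
    obtain T' Y' where "good_pair T' Y'" "q = profile T' Y'" using extremal_profile_good[OF \<open>q \<in> ?E\<close>] by blast
    then show ?thesis using good_pair_cross_size max0 by simp
  qed
  have mem0: "profile T0 Y0 \<in> ?E" by (rule optimal_profile_extremal[OF good0 max0])
  have M: "M = ?m" unfolding M_def
  proof (rule Max_eqI)
    show "?m \<in> cross_size p n k ` ?E"
      using mem0 good_pair_cross_size[OF good0] by (metis imageI)
  qed (use upper finite_extremal_profiles in auto)
  have cle: "card (cross T Y) \<le> card (cross T0 Y0)" by (rule max0[OF TY(1)])
  have le: "card \<F> \<le> card (cross T Y)"
    using TY(2) card_mono[OF finite_cross, of \<F> T Y] by linarith
  have only_if: "\<exists>T Y. feasible_pair p X k T Y \<and> card T = t \<and> card Y \<ge> 2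
     \<and> is_arg_max (cross_size p n k) (\<lambda>q. q \<in> ?E) (profile T Y) \<and> \<F> = cross T Y"
    if "int (card \<F>) = M"
  proof -
    have eq: "card \<F> = card (cross T0 Y0)" using that M by simp
    \<comment> \<open>Equality rules out the strict alternative of \<open>main_bound\<close>; the
      inclusion then becomes an equality by cardinality.\<close>
    then have sub: "\<F> \<subseteq> cross T Y" using TY(2) cle by linarith
    have "card (cross T Y) = card (cross T0 Y0)" using eq le cle by linarith
    then have opt: "card (cross T' Y') \<le> card (cross T Y)" if "good_pair T' Y'" for T' Y'
      using max0[OF that] by simp
    have "\<F> = cross T Y" by (rule card_seteq[OF finite_cross sub]) (use eq cle in simp)
    moreover have "is_arg_max (cross_size p n k) (\<lambda>q. q \<in> ?E) (profile T Y)"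
    proof -
      have "profile T Y \<in> ?E" by (rule optimal_profile_extremal[OF TY(1) opt])
      moreover have "\<not> cross_size p n k (profile T Y) < cross_size p n k q" if "q \<in> ?E" for q
        using upper[OF that] good_pair_cross_size[OF TY(1)] eq le by linarith
      ultimately show ?thesis unfolding is_arg_max_def by blast
    qed
    ultimately show ?thesis using TY(1) unfolding good_pair_def by blast
  qed
  have "if": "int (card \<F>) = M"
    if "is_arg_max (cross_size p n k) (\<lambda>q. q \<in> ?E) (profile T' Y')" "\<F> = cross T' Y'"
      "feasible_pair p X k T' Y'" "card T' = t" "2 \<le> card Y'" for T' Y'
  proof -
    have g: "good_pair T' Y'" using that by (simp add: good_pair_def)
    \<comment> \<open>The profile of the largest pair competes among the extremal ones, so a
      maximizer is at least as large.\<close>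
    have "\<not> cross_size p n k (profile T' Y') < cross_size p n k (profile T0 Y0)"
      using that(1) mem0 unfolding is_arg_max_def by blast
    then have "?m \<le> int (card (cross T' Y'))"
      using good_pair_cross_size[OF good0] good_pair_cross_size[OF g] by simp
    then show ?thesis using max0[OF g] M that(2) by simp
  qed
  have "int (card \<F>) \<le> M" using M le cle by simp
  moreover have "int (card \<F>) = M \<longleftrightarrow>
      (\<exists>T Y. feasible_pair p X k T Y \<and> card T = t \<and> card Y \<ge> 2
        \<and> is_arg_max (cross_size p n k) (\<lambda>q. q \<in> ?E) (profile T Y) \<and> \<F> = cross T Y)"
    by (rule iffI, erule only_if, elim exE conjE, rule "if")
  ultimately show ?thesis by (rule conjI)
qed

end

theorem theorem1p5:
  fixes p t K :: nat
    and k n :: "nat \<Rightarrow> nat"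
    and X :: "nat \<Rightarrow> 'a set"
    and \<F> :: "'a set set"
  assumes "p \<ge> 1" and "t \<ge> 1"
    and "\<forall>i\<in>{1..p}. k i \<ge> 1"
    and "\<forall>i\<in>{1..p}. finite (X i)"
    and "disjoint_family_on X {1..p}"
    and "\<forall>i\<in>{1..p}. card (X i) = n i"
    and "K = (\<Sum>i=1..p. k i)"
    and "K \<ge> t + 2"
    and "Min (n ` {1..p}) > K * (1 + Lambda_bound K t)"
    and "\<F> \<subseteq> block_family p X k"
    and "t_intersecting t \<F>"
    and "\<not> t_trivial p X t \<F>"
  shows "int (card \<F>) \<le> Max (cross_size p n k ` extremal_profiles p X k t)
    \<and> (int (card \<F>) = Max (cross_size p n k ` extremal_profiles p X k t) \<longleftrightarrow>
        (\<exists>T Y. feasible_pair p X k T Y \<and> card T = t \<and> card Y \<ge> 2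
           \<and> is_arg_max (cross_size p n k) (\<lambda>q. q \<in> extremal_profiles p X k t) (pair_profile p X T Y)
           \<and> \<F> = cross_family p X k T Y))"
proof -
  interpret large_blocks p k n X t K
  proof
    fix i assume i: "i \<in> {1..p}"
    show "finite (X i)" "card (X i) = n i" using assms(4,6) i by blast+
    have "Min (n ` {1..p}) \<le> n i" using i by (intro Min_le) auto
    then show "K * (1 + Lambda_bound K t) < n i" using assms(9) by linarith
  qed (fact assms(2,5,7,8))+
  show ?thesis using assms(10-12) by (rule nontrivial_intersecting_bound)
qed

end
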